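(* Let $T>0$, let $M=(M_t)_{t\in[0,T]}\neq 0$ be a continuous and square integrable martingale vanishing at $0$ whose quadratic variation $\langle M\rangle=(\langle M\rangle_t)_{t\in[0,T]}$ (a nonnegative, increasing and continuous process) is a deterministic function, and let $J_0$ be an unknown function which almost surely belongs to $\mathbb L^2([0,T],d\langle M\rangle_t)$. Let $N\in\mathbb N^*$, $m\in\{1,\dots,N\}$, let $\varphi_1,\dots,\varphi_N$ be continuous functions from $[0,T]$ into $\mathbb R$ such that $(\varphi_1,\dots,\varphi_N)$ is an orthonormal family in $\mathbb L^2([0,T],dt)$, and let $\mathcal S_m={\rm span}\{\varphi_1,\dots,\varphi_m\}$. Let $\widehat J_{m,N}$ be the projection least squares estimator of $J_0$ on $\mathcal S_m$ computed from $N$ independent copies of the process $Z$ (defined in the context). Then $$\mathbb E[\|\widehat J_{m,N}-J_0\|_{\langle M\rangle}^{2}]\leqslant\min_{J\in\mathcal S_m}\|J-J_0\|_{\langle M\rangle}^{2}+\frac{2m}{N}.$$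
   Context: The process $Z$ is $Z_t=\int_0^tJ_0(s)\,d\langle M\rangle_s+M_t$, $t\in[0,T]$. $M^1,\dots,M^N$ (resp. $Z^1,\dots,Z^N$) are $N$ independent copies of $M$ (resp. $Z$), with $Z^i_t=\int_0^tJ_0(s)\,d\langle M\rangle_s+M^i_t$. Norm: $\|\varphi\|_{\langle M\rangle}^2=\int_0^T\varphi(s)^2\,d\langle M\rangle_s$ on $\mathbb L^2([0,T],d\langle M\rangle_t)$. Estimator: for $J\in\mathcal S_m$, $$\gamma_N(J)=\frac1N\sum_{i=1}^N\left(\int_0^TJ(s)^2\,d\langle M^i\rangle_s-2\int_0^TJ(s)\,dZ^i_s\right),$$ and $\widehat J_{m,N}=\arg\min_{J\in\mathcal S_m}\gamma_N(J)$. Explicitly, $\widehat J_{m,N}=\sum_{j=1}^m\widehat\theta_j\varphi_j$ with $(\widehat\theta_1,\dots,\widehat\theta_m)^*=\Psi_m^{-1}z_{m,N}$, where $\Psi_m=\left(\int_0^T\varphi_j(s)\varphi_k(s)\,d\langle M\rangle_s\right)_{j,k\in\{1,\dots,m\}}$ (symmetric and positive-definite, the $\varphi_j$'s being linearly independent) and $z_{m,N}=\left(\frac1N\sum_{i=1}^N\int_0^T\varphi_j(s)\,dZ^i_s\right)_{j\in\{1,\dots,m\}}$. *)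

theory Defs
  imports "HOL-Probability.Probability"
begin

definition is_filtration :: "'a measure \<Rightarrow> real \<Rightarrow> (real \<Rightarrow> 'a measure) \<Rightarrow> bool" where
  "is_filtration P T F \<longleftrightarrow>
     (\<forall>t\<in>{0..T}. subalgebra P (F t)) \<and>
     (\<forall>s\<in>{0..T}. \<forall>t\<in>{s..T}. sets (F s) \<subseteq> sets (F t))"

definition is_martingale ::
  "'a measure \<Rightarrow> (real \<Rightarrow> 'a measure) \<Rightarrow> real \<Rightarrow> (real \<Rightarrow> 'a \<Rightarrow> real) \<Rightarrow> bool" where
  "is_martingale P F T M \<longleftrightarrow>
     is_filtration P T F \<and>
     (\<forall>t\<in>{0..T}. M t \<in> borel_measurable (F t) \<and> integrable P (M t)) \<and>
     (\<forall>s\<in>{0..T}. \<forall>t\<in>{s..T}. AE \<omega> in P. real_cond_exp P (F s) (M t) \<omega> = M s \<omega>)"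

definition is_continuous_L2_martingale ::
  "'a measure \<Rightarrow> (real \<Rightarrow> 'a measure) \<Rightarrow> real \<Rightarrow> (real \<Rightarrow> 'a \<Rightarrow> real) \<Rightarrow> bool" where
  "is_continuous_L2_martingale P F T M \<longleftrightarrow>
     is_martingale P F T M \<and>
     (\<forall>t\<in>{0..T}. integrable P (\<lambda>\<omega>. (M t \<omega>)\<^sup>2)) \<and>
     (AE \<omega> in P. continuous_on {0..T} (\<lambda>t. M t \<omega>))"

text \<open>The quadratic variation is the angle bracket of a continuous square integrable
  martingale: the (up to indistinguishability unique) continuous, increasing, adapted process
  vanishing at \<open>0\<close> that compensates \<open>M\<^sup>2\<close>. Increasing is meant in the wide sense.\<close>

definition is_quadratic_variation ::
  "'a measure \<Rightarrow> (real \<Rightarrow> 'a measure) \<Rightarrow> real \<Rightarrow> (real \<Rightarrow> 'a \<Rightarrow> real) \<Rightarrow> (real \<Rightarrow> 'a \<Rightarrow> real) \<Rightarrow> bool" where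
  "is_quadratic_variation P F T M A \<longleftrightarrow>
     (\<forall>t\<in>{0..T}. A t \<in> borel_measurable (F t)) \<and>
     (AE \<omega> in P. A 0 \<omega> = 0 \<and> mono_on {0..T} (\<lambda>t. A t \<omega>) \<and> continuous_on {0..T} (\<lambda>t. A t \<omega>)) \<and>
     is_martingale P F T (\<lambda>t \<omega>. (M t \<omega>)\<^sup>2 - A t \<omega>)"

text \<open>The Lebesgue-Stieltjes measure \<open>dg\<close> on \<open>[0,T]\<close>; \<open>g\<close> is continued by constants outside of
  \<open>[0,T]\<close>, so only its values on \<open>[0,T]\<close> matter and all the mass lies there.\<close>

definition stieltjes :: "real \<Rightarrow> (real \<Rightarrow> real) \<Rightarrow> real measure" where
  "stieltjes T g = interval_measure (\<lambda>t. g (max 0 (min T t)))"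

definition in_L2 :: "real \<Rightarrow> (real \<Rightarrow> real) \<Rightarrow> (real \<Rightarrow> real) \<Rightarrow> bool" where
  "in_L2 T q J \<longleftrightarrow>
     set_borel_measurable borel {0..T} J \<and> set_integrable (stieltjes T q) {0..T} (\<lambda>s. (J s)\<^sup>2)"

definition sqnorm :: "real \<Rightarrow> (real \<Rightarrow> real) \<Rightarrow> (real \<Rightarrow> real) \<Rightarrow> real" where
  "sqnorm T q J = (LINT s:{0..T}|stieltjes T q. (J s)\<^sup>2)"

definition path :: "real \<Rightarrow> (real \<Rightarrow> 'a \<Rightarrow> real) \<Rightarrow> 'a \<Rightarrow> real \<Rightarrow> real" where
  "path t M \<omega> = (\<lambda>s\<in>{0..t}. M s \<omega>)"

definition path_space :: "real \<Rightarrow> (real \<Rightarrow> real) measure" where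
  "path_space t = PiM {0..t} (\<lambda>_. borel)"

definition natural_filtration :: "'a measure \<Rightarrow> (real \<Rightarrow> 'a \<Rightarrow> real) \<Rightarrow> real \<Rightarrow> 'a measure" where
  "natural_filtration P M t = vimage_algebra (space P) (path t M) (path_space t)"

text \<open>The copies may live on another probability space \<open>Q\<close>. Having the same law on the product
  \<open>\<sigma>\<close>-algebra together with continuity of the paths is equality in law as random elements of
  \<open>C([0,T])\<close>.\<close>

definition independent_copies ::
  "'b measure \<Rightarrow> 'a measure \<Rightarrow> real \<Rightarrow> nat \<Rightarrow> (nat \<Rightarrow> real \<Rightarrow> 'b \<Rightarrow> real) \<Rightarrow> (real \<Rightarrow> 'a \<Rightarrow> real) \<Rightarrow> bool" where
  "independent_copies Q P T N Ms M \<longleftrightarrow>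
     prob_space.indep_vars Q (\<lambda>_. path_space T) (\<lambda>i. path T (Ms i)) {1..N} \<and>
     (\<forall>i\<in>{1..N}. distr Q (path_space T) (path T (Ms i)) = distr P (path_space T) (path T M) \<and>
                 (AE \<omega> in Q. continuous_on {0..T} (\<lambda>t. Ms i t \<omega>)))"

text \<open>A simple predictable process \<open>\<Sum>k<n. \<xi> k * 1\<^bsub>(t k, t (k+1)]\<^esub>\<close> is encoded by \<open>n\<close>, \<open>t\<close>, \<open>\<xi>\<close>.\<close>

definition is_simple_predictable ::
  "'a measure \<Rightarrow> (real \<Rightarrow> 'a measure) \<Rightarrow> real \<Rightarrow> nat \<Rightarrow> (nat \<Rightarrow> real) \<Rightarrow> (nat \<Rightarrow> 'a \<Rightarrow> real) \<Rightarrow> bool" where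
  "is_simple_predictable P F T n t \<xi> \<longleftrightarrow>
     0 \<le> t 0 \<and> t n \<le> T \<and>
     (\<forall>k<n. t k \<le> t (Suc k) \<and> \<xi> k \<in> borel_measurable (F (t k)) \<and>
            (\<exists>C. \<forall>\<omega>\<in>space P. \<bar>\<xi> k \<omega>\<bar> \<le> C))"

definition simple_process ::
  "nat \<Rightarrow> (nat \<Rightarrow> real) \<Rightarrow> (nat \<Rightarrow> 'a \<Rightarrow> real) \<Rightarrow> real \<Rightarrow> 'a \<Rightarrow> real" where
  "simple_process n t \<xi> s \<omega> = (\<Sum>k<n. \<xi> k \<omega> * indicator {t k<..t (Suc k)} s)"

definition simple_integral ::
  "nat \<Rightarrow> (nat \<Rightarrow> real) \<Rightarrow> (nat \<Rightarrow> 'a \<Rightarrow> real) \<Rightarrow> (real \<Rightarrow> 'a \<Rightarrow> real) \<Rightarrow> 'a \<Rightarrow> real" where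
  "simple_integral n t \<xi> M \<omega> = (\<Sum>k<n. \<xi> k \<omega> * (M (t (Suc k)) \<omega> - M (t k) \<omega>))"

text \<open>\<open>X\<close> is a version of the Ito integral of \<open>H\<close> over \<open>[0,T]\<close> with respect to the martingale
  \<open>M\<close> with quadratic variation \<open>A\<close>: the \<open>L\<^sup>2\<close>-limit of the integrals of simple predictable
  processes which approximate \<open>H\<close> in \<open>L\<^sup>2(P \<otimes> dA)\<close>.\<close>

definition has_ito_integral ::
  "'a measure \<Rightarrow> (real \<Rightarrow> 'a measure) \<Rightarrow> real \<Rightarrow> (real \<Rightarrow> 'a \<Rightarrow> real) \<Rightarrow> (real \<Rightarrow> 'a \<Rightarrow> real) \<Rightarrow>
   (real \<Rightarrow> 'a \<Rightarrow> real) \<Rightarrow> ('a \<Rightarrow> real) \<Rightarrow> bool" where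
  "has_ito_integral P F T M A H X \<longleftrightarrow>
     X \<in> borel_measurable P \<and>
     (\<exists>n t \<xi>.
        (\<forall>l. is_simple_predictable P F T (n l) (t l) (\<xi> l)) \<and>
        (\<lambda>l::nat. \<integral>\<^sup>+\<omega>. (\<integral>\<^sup>+s\<in>{0..T}. ennreal ((simple_process (n l) (t l) (\<xi> l) s \<omega> - H s \<omega>)\<^sup>2)
                     \<partial>stieltjes T (\<lambda>r. A r \<omega>)) \<partial>P) \<longlonglongrightarrow> 0 \<and>
        (\<lambda>l. \<integral>\<^sup>+\<omega>. ennreal ((simple_integral (n l) (t l) (\<xi> l) M \<omega> - X \<omega>)\<^sup>2) \<partial>P) \<longlonglongrightarrow> 0)"

definition drift :: "real \<Rightarrow> (real \<Rightarrow> real) \<Rightarrow> (real \<Rightarrow> real) \<Rightarrow> real \<Rightarrow> real" where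
  "drift T q J t = (LINT s:{0..t}|stieltjes T q. J s)"

definition Zproc ::
  "real \<Rightarrow> (real \<Rightarrow> real) \<Rightarrow> (real \<Rightarrow> real) \<Rightarrow> (real \<Rightarrow> 'a \<Rightarrow> real) \<Rightarrow> real \<Rightarrow> 'a \<Rightarrow> real" where
  "Zproc T q J M t \<omega> = drift T q J t + M t \<omega>"

text \<open>\<open>X\<close> is a version of \<open>\<integral>\<^sub>0\<^sup>T h(s) dZ\<^sub>s\<close>, where \<open>Z\<close> is a semimartingale with drift
  \<open>J dq\<close> and with \<open>A\<close> the quadratic variation of its martingale part: the sum of the
  Stieltjes integral of \<open>h J\<close> with respect to \<open>q\<close> and of the Ito integral of \<open>h\<close> with respect to
  the martingale part of \<open>Z\<close>.\<close>

definition has_Z_integral ::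
  "'a measure \<Rightarrow> (real \<Rightarrow> 'a measure) \<Rightarrow> real \<Rightarrow> (real \<Rightarrow> real) \<Rightarrow> (real \<Rightarrow> real) \<Rightarrow>
   (real \<Rightarrow> 'a \<Rightarrow> real) \<Rightarrow> (real \<Rightarrow> 'a \<Rightarrow> real) \<Rightarrow> (real \<Rightarrow> real) \<Rightarrow> ('a \<Rightarrow> real) \<Rightarrow> bool" where
  "has_Z_integral P F T q J Z A h X \<longleftrightarrow>
     has_ito_integral P F T (\<lambda>t \<omega>. Z t \<omega> - drift T q J t) A (\<lambda>s _. h s)
       (\<lambda>\<omega>. X \<omega> - (LINT s:{0..T}|stieltjes T q. h s * J s))"

definition orthonormal_family :: "real \<Rightarrow> nat \<Rightarrow> (nat \<Rightarrow> real \<Rightarrow> real) \<Rightarrow> bool" where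
  "orthonormal_family T N \<phi> \<longleftrightarrow>
     (\<forall>j\<in>{1..N}. \<forall>k\<in>{1..N}.
        (LINT s:{0..T}|lborel. \<phi> j s * \<phi> k s) = (if j = k then 1 else 0))"

definition fun_span :: "nat \<Rightarrow> (nat \<Rightarrow> real \<Rightarrow> real) \<Rightarrow> (real \<Rightarrow> real) set" where
  "fun_span m \<phi> = {J. \<exists>\<theta>. J = (\<lambda>s. \<Sum>j=1..m. \<theta> j * \<phi> j s)}"

definition linear_on_funs :: "(real \<Rightarrow> real) set \<Rightarrow> ((real \<Rightarrow> real) \<Rightarrow> real) \<Rightarrow> bool" where
  "linear_on_funs S L \<longleftrightarrow>
     (\<forall>f\<in>S. \<forall>g\<in>S. \<forall>a b. L (\<lambda>s. a * f s + b * g s) = a * L f + b * L g)"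

text \<open>The least squares contrast \<open>\<gamma>\<^sub>N(J)\<close> at \<open>\<omega>\<close>; \<open>A i\<close> is the quadratic variation of the
  \<open>i\<close>-th copy and \<open>I i J\<close> stands for the stochastic integral of \<open>J\<close> with respect to the \<open>i\<close>-th
  copy of \<open>Z\<close>.\<close>

definition contrast ::
  "real \<Rightarrow> nat \<Rightarrow> (nat \<Rightarrow> real \<Rightarrow> 'b \<Rightarrow> real) \<Rightarrow> (nat \<Rightarrow> (real \<Rightarrow> real) \<Rightarrow> 'b \<Rightarrow> real) \<Rightarrow>
   'b \<Rightarrow> (real \<Rightarrow> real) \<Rightarrow> real" where
  "contrast T N A I \<omega> J =
     1 / real N * (\<Sum>i=1..N. (LINT s:{0..T}|stieltjes T (\<lambda>t. A i t \<omega>). (J s)\<^sup>2) - 2 * I i J \<omega>)"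

text \<open>Stochastic integrals are only defined up to null sets. The pathwise minimisation of the
  contrast over the uncountable set \<open>S\<close> makes sense once the versions \<open>I i J\<close> are chosen
  so as to depend linearly on \<open>J \<in> S\<close>, as is done when they are computed from a basis of \<open>S\<close>.\<close>

definition is_integral_family ::
  "'b measure \<Rightarrow> real \<Rightarrow> (real \<Rightarrow> real) \<Rightarrow> (real \<Rightarrow> real) \<Rightarrow> nat \<Rightarrow> (nat \<Rightarrow> real \<Rightarrow> 'b \<Rightarrow> real) \<Rightarrow>
   (nat \<Rightarrow> real \<Rightarrow> 'b \<Rightarrow> real) \<Rightarrow> (real \<Rightarrow> real) set \<Rightarrow> (nat \<Rightarrow> (real \<Rightarrow> real) \<Rightarrow> 'b \<Rightarrow> real) \<Rightarrow> bool" where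
  "is_integral_family Q T q J\<^sub>0 N Ms A S I \<longleftrightarrow>
     (\<forall>i\<in>{1..N}.
        (\<forall>J\<in>S. has_Z_integral Q (natural_filtration Q (Ms i)) T q J\<^sub>0
                 (Zproc T q J\<^sub>0 (Ms i)) (A i) J (I i J)) \<and>
        (\<forall>\<omega>\<in>space Q. linear_on_funs S (\<lambda>J. I i J \<omega>)))"

text \<open>No uniqueness is built in: if \<open>q\<close> is constant on some interval, functions that are linearly
  independent on \<open>[0,T]\<close> may be dependent in \<open>L\<^sup>2(dq)\<close>, and the contrast may then have several
  minimisers in \<open>S\<close>, all of them equal in \<open>L\<^sup>2(dq)\<close>.\<close>

definition is_ls_estimator ::
  "'b measure \<Rightarrow> real \<Rightarrow> nat \<Rightarrow> (nat \<Rightarrow> real \<Rightarrow> 'b \<Rightarrow> real) \<Rightarrow> (nat \<Rightarrow> (real \<Rightarrow> real) \<Rightarrow> 'b \<Rightarrow> real) \<Rightarrow>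
   (real \<Rightarrow> real) set \<Rightarrow> ('b \<Rightarrow> real \<Rightarrow> real) \<Rightarrow> bool" where
  "is_ls_estimator Q T N A I S Jhat \<longleftrightarrow>
     (AE \<omega> in Q. is_arg_min (contrast T N A I \<omega>) (\<lambda>J. J \<in> S) (Jhat \<omega>))"

end

theory Submission
  imports Defs
begin

text \<open>
  The estimator \<open>Jhat\<close> minimises, over the span \<open>S\<close> of \<open>\<phi> 1, \<dots>, \<phi> m\<close>, a contrast that differs from
  \<open>\<parallel>J - J\<^sub>0\<parallel>\<^sup>2\<close> by a constant and by \<open>-2 W J\<close>, where \<open>W J\<close> is the mean over the \<open>N\<close> copies of the
  martingale integrals \<open>\<integral>J dM\<^sup>i\<close>. Take vectors \<open>e\<close> of \<open>S\<close>, at most \<open>m\<close> of them, orthonormal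
  in \<open>L\<^sup>2(dq)\<close> and spanning \<open>S\<close> up to functions of norm zero
  (\<open>semidefinite_orthonormal_family\<close>). The normal equations say that the coordinate of \<open>Jhat\<close> along
  \<open>e\<close> is that of \<open>J\<^sub>0\<close> plus \<open>W e\<close> (\<open>contrast_minimiser_coordinate\<close>). By Pythagoras
  (\<open>sqnorm_diff_coordinates\<close>) the loss is the squared distance of \<open>J\<^sub>0\<close> to \<open>S\<close> plus the
  sum of the \<open>(W e)\<^sup>2\<close>.

  Each \<open>W e\<close> is a mean of \<open>N\<close> independent centred variables whose second moment is, by the Ito isometry,
  at most \<open>\<parallel>e\<parallel>\<^sup>2 = 1\<close>; so \<open>(W e)\<^sup>2\<close> has expectation at most \<open>1 / N\<close>
  (\<open>sum_ito_integrals_second_moment\<close>), and the sum over \<open>e\<close> at most \<open>m / N\<close>, half of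
  the claimed variance term. The isometry is proved for simple integrands and
  carried over to the limit as an upper bound.

  The brackets \<open>A i\<close> of the copies are random processes, and both the contrast and
  the integrals are expressed in terms of them. They have to be identified with \<open>q\<close>. Equality in law
  makes \<open>Ms i\<close> and \<open>(Ms i)\<^sup>2 - q\<close> martingales in the natural filtration of \<open>Ms i\<close>
  (\<open>martingale_same_law\<close>), so \<open>q\<close> is a bracket of \<open>Ms i\<close> as well, and the bracket is unique
  (\<open>deterministic_bracket_unique_path\<close>). Uniqueness is obtained from the strict convexity of the
  exponential: a continuous martingale \<open>X\<close> of bounded variation that starts at \<open>0\<close> and is bounded
  below satisfies \<open>E (exp (-X)) = 1 = exp (-E X)\<close>, the case of equality in Jensen's inequality.
\<close>

section \<open>Square integrable functions for a Stieltjes measure\<close>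

text \<open>The measure \<open>dq\<close> is built from \<open>q\<close> stopped at the ends of \<open>[0,T]\<close>. Monotonicity and
  continuity survive the stopping, which is what the construction of interval measures asks of a
  distribution function on the whole line.\<close>

lemma clamp_mono_continuous:
  fixes q :: "real \<Rightarrow> real"
  assumes T: "0 < T" and mono: "mono_on {0..T} q" and cont: "continuous_on {0..T} q"
  shows "mono (\<lambda>t. q (max 0 (min T t)))"
    and "continuous_on UNIV (\<lambda>t. q (max 0 (min T t)))"
proof -
  show "mono (\<lambda>t. q (max 0 (min T t)))"
    using T by (intro monoI mono_onD[OF mono]) auto
  show "continuous_on UNIV (\<lambda>t. q (max 0 (min T t)))"
    using T by (intro continuous_on_compose2[OF cont] continuous_intros) auto
qed

lemma sets_stieltjes [simp, measurable_cong]: "sets (stieltjes T q) = sets borel"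
  by (simp add: stieltjes_def)

lemma stieltjes_cong:
  assumes "0 < T" "\<And>t. t \<in> {0..T} \<Longrightarrow> g t = h t"
  shows "stieltjes T g = stieltjes T h"
proof -
  have "(\<lambda>t. g (max 0 (min T t))) = (\<lambda>t. h (max 0 (min T t)))"
    using assms by (intro ext assms(2)) auto
  then show ?thesis by (simp add: stieltjes_def)
qed

lemma emeasure_stieltjes_Ioc:
  assumes T: "0 < T" and mono: "mono_on {0..T} q" and cont: "continuous_on {0..T} q"
    and "a \<le> b"
  shows "emeasure (stieltjes T q) {a<..b} = ennreal (q (max 0 (min T b)) - q (max 0 (min T a)))"
  unfolding stieltjes_def
proof (rule emeasure_interval_measure_Ioc[OF \<open>a \<le> b\<close>])
  show "q (max 0 (min T x)) \<le> q (max 0 (min T y))" if "x \<le> y" for x y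
    using clamp_mono_continuous(1)[OF T mono cont] that by (rule monoD)
  show "continuous (at_right a) (\<lambda>t. q (max 0 (min T t)))" for a
    using clamp_mono_continuous(2)[OF T mono cont]
    by (simp add: continuous_at_imp_continuous_at_within continuous_on_eq_continuous_at)
qed

lemma emeasure_stieltjes_finite:
  assumes T: "0 < T" and mono: "mono_on {0..T} q" and cont: "continuous_on {0..T} q"
  shows "emeasure (stieltjes T q) {0..T} < \<infinity>"
proof -
  have "emeasure (stieltjes T q) {0..T} \<le> emeasure (stieltjes T q) {-1<..T}"
    by (intro emeasure_mono) auto
  also have "\<dots> < \<infinity>"
    using emeasure_stieltjes_Ioc[OF T mono cont, of "-1" T] T by simp
  finally show ?thesis .
qed

lemma sigma_finite_stieltjes:
  assumes T: "0 < T" and mono: "mono_on {0..T} q" and cont: "continuous_on {0..T} q"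
  shows "sigma_finite_measure (stieltjes T q)"
  unfolding stieltjes_def
proof (rule sigma_finite_interval_measure)
  show "q (max 0 (min T x)) \<le> q (max 0 (min T y))" if "x \<le> y" for x y
    using clamp_mono_continuous(1)[OF T mono cont] that by (rule monoD)
  show "continuous (at_right a) (\<lambda>t. q (max 0 (min T t)))" for a
    using clamp_mono_continuous(2)[OF T mono cont]
    by (simp add: continuous_at_imp_continuous_at_within continuous_on_eq_continuous_at)
qed

definition inner_L2 :: "real \<Rightarrow> (real \<Rightarrow> real) \<Rightarrow> (real \<Rightarrow> real) \<Rightarrow> (real \<Rightarrow> real) \<Rightarrow> real" where
  "inner_L2 T q f g = (LINT s:{0..T}|stieltjes T q. f s * g s)"

lemma sqnorm_eq_inner_L2: "sqnorm T q f = inner_L2 T q f f"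
  by (simp add: sqnorm_def inner_L2_def power2_eq_square)

lemma inner_L2_commute: "inner_L2 T q f g = inner_L2 T q g f"
  by (simp add: inner_L2_def mult.commute)

lemma inner_L2_nonneg: "inner_L2 T q f f \<ge> 0"
  unfolding inner_L2_def set_lebesgue_integral_def
  by (intro integral_nonneg_AE) (auto simp: indicator_def)

lemma in_L2_measurable:
  "in_L2 T q f \<Longrightarrow> (\<lambda>s. indicator {0..T} s * f s) \<in> borel_measurable borel"
  by (simp add: in_L2_def set_borel_measurable_def)

lemma abs_mult_le_sum_squares:
  fixes x y :: real
  shows "\<bar>x * y\<bar> \<le> x\<^sup>2 + y\<^sup>2"
proof -
  have "0 \<le> (\<bar>x\<bar> - \<bar>y\<bar>)\<^sup>2" "0 \<le> \<bar>x\<bar> * \<bar>y\<bar>" by auto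
  then show ?thesis unfolding power2_diff power2_abs abs_mult by linarith
qed

lemma in_L2_mult_integrable:
  assumes f: "in_L2 T q f" and g: "in_L2 T q g"
  shows "set_integrable (stieltjes T q) {0..T} (\<lambda>s. f s * g s)"
proof -
  have m: "(\<lambda>s. (indicator {0..T} s * f s) * (indicator {0..T} s * g s)) \<in> borel_measurable borel"
    using in_L2_measurable[OF f] in_L2_measurable[OF g] by (rule borel_measurable_times)
  have "integrable (stieltjes T q)
      (\<lambda>s. indicator {0..T} s * (f s)\<^sup>2 + indicator {0..T} s * (g s)\<^sup>2)"
    using f g by (auto simp: in_L2_def set_integrable_def)
  then have "integrable (stieltjes T q)
      (\<lambda>s. (indicator {0..T} s * f s) * (indicator {0..T} s * g s))"
  proof (rule Bochner_Integration.integrable_bound)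
    show "(\<lambda>s. (indicator {0..T} s * f s) * (indicator {0..T} s * g s))
        \<in> borel_measurable (stieltjes T q)"
      using m by (simp cong: measurable_cong_sets)
    show "AE s in stieltjes T q. norm (indicator {0..T} s * f s * (indicator {0..T} s * g s))
       \<le> norm (indicator {0..T} s * (f s)\<^sup>2 + indicator {0..T} s * (g s)\<^sup>2)"
      using abs_mult_le_sum_squares by (intro AE_I2) (auto simp: indicator_def)
  qed
  moreover have "(\<lambda>s. (indicator {0..T} s * f s) * (indicator {0..T} s * g s))
      = (\<lambda>s. indicator {0..T} s * (f s * g s))"
    by (auto simp: indicator_def)
  ultimately show ?thesis by (simp add: set_integrable_def)
qed

lemma in_L2_lincomb:
  assumes f: "in_L2 T q f" and g: "in_L2 T q g"
  shows "in_L2 T q (\<lambda>s. a * f s + b * g s)"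
proof -
  have "(\<lambda>s. a * (indicator {0..T} s * f s) + b * (indicator {0..T} s * g s))
      \<in> borel_measurable borel"
    using in_L2_measurable[OF f] in_L2_measurable[OF g] by measurable
  moreover have "(\<lambda>s. a * (indicator {0..T} s * f s) + b * (indicator {0..T} s * g s))
      = (\<lambda>s. indicator {0..T} s * (a * f s + b * g s))"
    by (auto simp: algebra_simps)
  ultimately have m: "set_borel_measurable borel {0..T} (\<lambda>s. a * f s + b * g s)"
    by (simp add: set_borel_measurable_def)
  have "set_integrable (stieltjes T q) {0..T}
      (\<lambda>s. a\<^sup>2 * (f s * f s) + ((2 * a * b) * (f s * g s) + b\<^sup>2 * (g s * g s)))"
    by (intro set_integral_add set_integrable_mult_right in_L2_mult_integrable f g)
  moreover have "(\<lambda>s. a\<^sup>2 * (f s * f s) + ((2 * a * b) * (f s * g s) + b\<^sup>2 * (g s * g s)))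
      = (\<lambda>s. (a * f s + b * g s)\<^sup>2)"
    by (auto simp: power2_eq_square algebra_simps)
  ultimately show ?thesis using m by (simp add: in_L2_def)
qed

lemma inner_L2_lincomb:
  assumes "in_L2 T q f" "in_L2 T q g" "in_L2 T q h"
  shows "inner_L2 T q (\<lambda>s. a * f s + b * g s) h = a * inner_L2 T q f h + b * inner_L2 T q g h"
proof -
  have *: "(\<lambda>s. (a * f s + b * g s) * h s) = (\<lambda>s. a * (f s * h s) + b * (g s * h s))"
    by (auto simp: algebra_simps)
  show ?thesis
    unfolding inner_L2_def *
    using in_L2_mult_integrable[OF assms(1,3)] in_L2_mult_integrable[OF assms(2,3)]
    by (subst set_integral_add(2)) auto
qed

lemma continuous_in_L2:
  assumes T: "0 < T" and mono: "mono_on {0..T} q" and cont: "continuous_on {0..T} q"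
    and f: "continuous_on {0..T} f"
  shows "in_L2 T q f"
proof -
  have m: "set_borel_measurable borel {0..T} g" if "continuous_on {0..T} g" for g :: "real \<Rightarrow> real"
    using borel_measurable_continuous_on_indicator[OF _ that]
    by (simp add: set_borel_measurable_def)
  have "compact ((\<lambda>s. (f s)\<^sup>2) ` {0..T})"
    by (intro compact_continuous_image continuous_intros f) auto
  then obtain C where C: "\<And>s. s \<in> {0..T} \<Longrightarrow> \<bar>(f s)\<^sup>2\<bar> \<le> C"
    by (fastforce dest!: compact_imp_bounded simp: bounded_iff)
  have "set_integrable (stieltjes T q) {0..T} (\<lambda>s. (f s)\<^sup>2)"
    unfolding set_integrable_def
  proof (rule integrableI_bounded_set[where A = "{0..T}" and B = C])
    show "(\<lambda>s. indicator {0..T} s *\<^sub>R (f s)\<^sup>2) \<in> borel_measurable (stieltjes T q)"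
      using m[of "\<lambda>s. (f s)\<^sup>2"] f
      by (simp add: set_borel_measurable_def continuous_intros cong: measurable_cong_sets)
    show "emeasure (stieltjes T q) {0..T} < \<infinity>"
      by (rule emeasure_stieltjes_finite[OF T mono cont])
  qed (use C in auto)
  then show ?thesis using m[OF f] by (simp add: in_L2_def)
qed

section \<open>Orthonormal families for a semidefinite form\<close>

lemma fun_spanI: "J = (\<lambda>s. \<Sum>j=1..m. \<theta> j * \<phi> j s) \<Longrightarrow> J \<in> fun_span m \<phi>"
  by (auto simp: fun_span_def)

lemma fun_span_lincomb:
  assumes "f \<in> fun_span m \<phi>" "g \<in> fun_span m \<phi>"
  shows "(\<lambda>s. a * f s + b * g s) \<in> fun_span m \<phi>"
proof -
  obtain \<theta> \<eta> where "f = (\<lambda>s. \<Sum>j=1..m. \<theta> j * \<phi> j s)" "g = (\<lambda>s. \<Sum>j=1..m. \<eta> j * \<phi> j s)"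
    using assms unfolding fun_span_def by blast
  then have "(\<lambda>s. a * f s + b * g s) = (\<lambda>s. \<Sum>j=1..m. (a * \<theta> j + b * \<eta> j) * \<phi> j s)"
    by (auto simp: sum_distrib_left sum.distrib algebra_simps)
  then show ?thesis by (rule fun_spanI[where \<theta> = "\<lambda>j. a * \<theta> j + b * \<eta> j"])
qed

lemma zero_in_fun_span: "(\<lambda>_. 0) \<in> fun_span m \<phi>"
  unfolding fun_span_def by (auto intro!: exI[of _ "\<lambda>_. 0"])

lemma fun_span_SucE:
  assumes "J \<in> fun_span (Suc m) \<phi>"
  obtains J' c where "J' \<in> fun_span m \<phi>" "J = (\<lambda>s. 1 * J' s + c * \<phi> (Suc m) s)"
proof -
  obtain \<theta> where "J = (\<lambda>s. \<Sum>j=1..Suc m. \<theta> j * \<phi> j s)"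
    using assms unfolding fun_span_def by blast
  then have "J = (\<lambda>s. 1 * (\<Sum>j=1..m. \<theta> j * \<phi> j s) + \<theta> (Suc m) * \<phi> (Suc m) s)"
    by auto
  then show ?thesis
    by (intro that[of "\<lambda>s. \<Sum>j=1..m. \<theta> j * \<phi> j s" "\<theta> (Suc m)"]) (auto simp: fun_span_def)
qed

lemma fun_span_mono_Suc: "fun_span m \<phi> \<subseteq> fun_span (Suc m) \<phi>"
proof
  fix J assume "J \<in> fun_span m \<phi>"
  then obtain \<theta> where J: "J = (\<lambda>s. \<Sum>j=1..m. \<theta> j * \<phi> j s)"
    unfolding fun_span_def by blast
  have "J = (\<lambda>s. \<Sum>j=1..Suc m. (\<theta>(Suc m := 0)) j * \<phi> j s)"
    by (auto simp: J intro!: ext sum.cong)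
  then show "J \<in> fun_span (Suc m) \<phi>" by (rule fun_spanI)
qed

lemma basis_in_fun_span: "\<phi> (Suc m) \<in> fun_span (Suc m) \<phi>"
proof -
  have "\<phi> (Suc m) = (\<lambda>s. \<Sum>j=1..Suc m. (if j = Suc m then 1 else 0) * \<phi> j s)"
    by (auto intro!: ext)
  then show ?thesis by (rule fun_spanI[where \<theta> = "\<lambda>j. if j = Suc m then 1 else 0"])
qed

text \<open>Gram-Schmidt for a form that is only positive semidefinite: when \<open>dq\<close> misses an interval,
  functions that are linearly independent on \<open>[0,T]\<close> may become dependent in \<open>L\<^sup>2(dq)\<close>. A new
  vector whose component orthogonal to the family found so far has length zero is simply
  dropped; that component is then orthogonal to everything, so the Parseval identity stays valid
  even against test functions \<open>h\<close> outside of the span. This is why fewer than \<open>m\<close> vectors may be left.\<close>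

lemma semidefinite_orthonormal_family:
  fixes B :: "(real \<Rightarrow> real) \<Rightarrow> (real \<Rightarrow> real) \<Rightarrow> real"
  assumes V: "\<And>a b f g. f \<in> V \<Longrightarrow> g \<in> V \<Longrightarrow> (\<lambda>s. a * f s + b * g s) \<in> V"
    and zero: "(\<lambda>_. 0) \<in> V"
    and sym: "\<And>f g. B f g = B g f"
    and lin: "\<And>a b f g h. f \<in> V \<Longrightarrow> g \<in> V \<Longrightarrow> h \<in> V \<Longrightarrow>
        B (\<lambda>s. a * f s + b * g s) h = a * B f h + b * B g h"
    and pos: "\<And>f. B f f \<ge> 0"
    and \<phi>: "\<And>j. j \<in> {1..m} \<Longrightarrow> \<phi> j \<in> V"
  shows "\<exists>E. finite E \<and> card E \<le> m \<and> E \<subseteq> fun_span m \<phi> \<inter> V \<and>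
    (\<forall>e\<in>E. \<forall>e'\<in>E. B e e' = (if e = e' then 1 else 0)) \<and>
    (\<forall>J\<in>fun_span m \<phi>. J \<in> V \<and> (\<forall>h\<in>V. B J h = (\<Sum>e\<in>E. B J e * B e h)))"
  using \<phi>
proof (induction m)
  case 0
  have "fun_span 0 \<phi> = {\<lambda>_. 0}" by (auto simp: fun_span_def)
  moreover have "B (\<lambda>_. 0) h = 0" if "h \<in> V" for h
    using lin[OF zero zero that, of 0 0] by simp
  ultimately show ?case using zero by (intro exI[of _ "{}"]) auto
next
  case (Suc m)
  have "\<phi> j \<in> V" if "j \<in> {1..m}" for j
    using Suc.prems[of j] that by auto
  from Suc.IH[OF this] obtain E where E: "finite E" "card E \<le> m" "E \<subseteq> fun_span m \<phi> \<inter> V"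
    and on': "\<forall>e\<in>E. \<forall>e'\<in>E. B e e' = (if e = e' then 1 else 0)"
    and pars': "\<forall>J\<in>fun_span m \<phi>. J \<in> V \<and> (\<forall>h\<in>V. B J h = (\<Sum>e\<in>E. B J e * B e h))"
    by blast
  have on: "\<And>e e'. e \<in> E \<Longrightarrow> e' \<in> E \<Longrightarrow> B e e' = (if e = e' then 1 else 0)"
    using on' by blast
  have span_V: "\<And>J. J \<in> fun_span m \<phi> \<Longrightarrow> J \<in> V"
    and pars: "\<And>J h. J \<in> fun_span m \<phi> \<Longrightarrow> h \<in> V \<Longrightarrow> B J h = (\<Sum>e\<in>E. B J e * B e h)"
    using pars' by blast+
  define f where "f = \<phi> (Suc m)"
  have fV: "f \<in> V" unfolding f_def by (rule Suc.prems) simp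
  have f_span: "f \<in> fun_span (Suc m) \<phi>" unfolding f_def by (rule basis_in_fun_span)
  have sums: "(\<lambda>s. \<Sum>e\<in>D. c e * e s) \<in> fun_span m \<phi> \<and>
      (\<forall>h\<in>V. B (\<lambda>s. \<Sum>e\<in>D. c e * e s) h = (\<Sum>e\<in>D. c e * B e h))"
    if "finite D" "D \<subseteq> E" for D and c :: "_ \<Rightarrow> real"
    using that
  proof (induction D rule: finite_induct)
    case empty
    have "B (\<lambda>_. 0) h = 0" if "h \<in> V" for h
      using lin[OF zero zero that, of 0 0] by simp
    then show ?case by (simp add: zero_in_fun_span)
  next
    case (insert x D)
    have eq: "(\<lambda>s. \<Sum>e\<in>insert x D. c e * e s) = (\<lambda>s. c x * x s + 1 * (\<Sum>e\<in>D. c e * e s))"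
      using insert.hyps by auto
    have x: "x \<in> fun_span m \<phi>" using insert.prems E(3) by auto
    have IH: "(\<lambda>s. \<Sum>e\<in>D. c e * e s) \<in> fun_span m \<phi>"
      "\<And>h. h \<in> V \<Longrightarrow> B (\<lambda>s. \<Sum>e\<in>D. c e * e s) h = (\<Sum>e\<in>D. c e * B e h)"
      using insert.IH insert.prems by auto
    have "B (\<lambda>s. c x * x s + 1 * (\<Sum>e\<in>D. c e * e s)) h = (\<Sum>e\<in>insert x D. c e * B e h)"
      if "h \<in> V" for h
      using lin[OF span_V[OF x] span_V[OF IH(1)] that, of "c x" 1] IH(2)[OF that] insert.hyps
      by simp
    then show ?case
      unfolding eq using fun_span_lincomb[OF x IH(1)] by blast
  qed
  define p where "p = (\<lambda>s. \<Sum>e\<in>E. B f e * e s)"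
  have p: "p \<in> fun_span m \<phi>" and Bp: "\<And>h. h \<in> V \<Longrightarrow> B p h = (\<Sum>e\<in>E. B f e * B e h)"
    using sums[OF E(1) order_refl, of "B f"] by (auto simp: p_def)
  define g where "g = (\<lambda>s. 1 * f s + (-1) * p s)"
  have gV: "g \<in> V" unfolding g_def by (intro V fV span_V p)
  have g_span: "g \<in> fun_span (Suc m) \<phi>"
    unfolding g_def using p fun_span_mono_Suc by (intro fun_span_lincomb f_span) blast
  have Bg: "B g h = B f h - (\<Sum>e\<in>E. B f e * B e h)" if "h \<in> V" for h
    unfolding g_def using lin[OF fV span_V[OF p] that, of 1 "-1"] Bp[OF that] by simp
  have Bge: "B g e = 0" if "e \<in> E" for e
  proof -
    have "(\<Sum>e'\<in>E. B f e' * B e' e) = (\<Sum>e'\<in>E. if e' = e then B f e' else 0)"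
      using on that by (intro sum.cong) auto
    then show ?thesis using Bg[of e] that E(1,3) by (auto simp: sum.delta)
  qed
  have eV: "e \<in> V" if "e \<in> E" for e using that E(3) by auto
  have extend: "J \<in> V \<and> (\<forall>h\<in>V. B J h = (\<Sum>e\<in>D. B J e * B e h))"
    if J: "J \<in> fun_span (Suc m) \<phi>" and D: "D \<subseteq> V"
      and 1: "\<And>J h. J \<in> fun_span m \<phi> \<Longrightarrow> h \<in> V \<Longrightarrow> B J h = (\<Sum>e\<in>D. B J e * B e h)"
      and 2: "\<And>h. h \<in> V \<Longrightarrow> B f h = (\<Sum>e\<in>D. B f e * B e h)" for J D
  proof -
    obtain J' c where J': "J' \<in> fun_span m \<phi>" "J = (\<lambda>s. 1 * J' s + c * f s)"
      using fun_span_SucE[OF J] unfolding f_def by blast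
    have B: "B J h = B J' h + c * B f h" if "h \<in> V" for h
      unfolding J'(2) using lin[OF span_V[OF J'(1)] fV that, of 1 c] by simp
    have "B J h = (\<Sum>e\<in>D. B J e * B e h)" if h: "h \<in> V" for h
    proof -
      have "(\<Sum>e\<in>D. B J e * B e h) = (\<Sum>e\<in>D. B J' e * B e h + c * (B f e * B e h))"
        using B D by (intro sum.cong) (auto simp: algebra_simps)
      also have "\<dots> = B J' h + c * B f h"
        using 1[OF J'(1) h] 2[OF h] by (simp add: sum.distrib sum_distrib_left)
      finally show ?thesis using B[OF h] by simp
    qed
    moreover have "J \<in> V" unfolding J'(2) by (intro V span_V J' fV)
    ultimately show ?thesis by blast
  qed
  show ?case
  proof (cases "B g g = 0")
    case True
    \<comment> \<open>The Cauchy-Schwarz argument: otherwise \<open>h + x g\<close> has square length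
      \<open>B h h + 2 x B g h\<close>, which takes the value \<open>-1\<close> for the following \<open>x\<close>.\<close>
    have Bg0: "B g h = 0" if h: "h \<in> V" for h
    proof (rule ccontr)
      assume nz: "B g h \<noteq> 0"
      define x where "x = - (B h h + 1) / (2 * B g h)"
      have 1: "B (\<lambda>s. x * g s + 1 * h s) k = x * B g k + B h k" if "k \<in> V" for k
        using lin[OF gV h that, of x 1] by simp
      have "B (\<lambda>s. x * g s + 1 * h s) (\<lambda>s. x * g s + 1 * h s) = 2 * x * B g h + B h h"
        using 1[OF V[OF gV h, of x 1]] 1[OF gV] 1[OF h] True
          sym[of g "\<lambda>s. x * g s + 1 * h s"] sym[of h "\<lambda>s. x * g s + 1 * h s"] sym[of g h]
        by simp
      also have "2 * x * B g h = - (B h h + 1)" using nz by (simp add: x_def)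
      finally show False using pos[of "\<lambda>s. x * g s + 1 * h s"] by simp
    qed
    then have "B f h = (\<Sum>e\<in>E. B f e * B e h)" if "h \<in> V" for h
      using Bg that by fastforce
    then have "\<forall>J\<in>fun_span (Suc m) \<phi>. J \<in> V \<and> (\<forall>h\<in>V. B J h = (\<Sum>e\<in>E. B J e * B e h))"
      using extend[of _ E] pars E(3) by blast
    then show ?thesis
      using E on fun_span_mono_Suc[of m \<phi>] by (intro exI[of _ E]) auto
  next
    case False
    define c where "c = sqrt (B g g)"
    have c: "c > 0" "c * c = B g g" using False pos[of g] by (auto simp: c_def)
    define e where "e = (\<lambda>s. (1 / c) * g s + 0 * g s)"
    have eV': "e \<in> V" unfolding e_def by (intro V gV)
    have e_span: "e \<in> fun_span (Suc m) \<phi>" unfolding e_def by (intro fun_span_lincomb g_span)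
    have Be: "B e h = B g h / c" if "h \<in> V" for h
      unfolding e_def using lin[OF gV gV that, of "1 / c" 0] by simp
    have ge: "B g e = c" using Be[OF gV] sym[of g e] c(1) c(2)[symmetric] by simp
    have ee: "B e e = 1" using Be[OF eV'] ge c by simp
    have eE: "B e e' = 0" "B e' e = 0" if "e' \<in> E" for e'
      using Be[OF eV[OF that]] Bge[OF that] sym[of e e'] by auto
    have notin: "e \<notin> E" using eE(1) ee by auto
    have fe: "B f e = c" using Bg[OF eV'] ge eE by simp
    have "B f h = (\<Sum>e'\<in>insert e E. B f e' * B e' h)" if h: "h \<in> V" for h
      using Bg[OF h] Be[OF h] fe c notin E(1) by simp
    moreover have "B J h = (\<Sum>e'\<in>insert e E. B J e' * B e' h)"
      if "J \<in> fun_span m \<phi>" "h \<in> V" for J h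
    proof -
      have "B J e = 0" using pars[OF that(1) eV'] eE by simp
      then show ?thesis using pars[OF that] notin E(1) by simp
    qed
    ultimately have "\<forall>J\<in>fun_span (Suc m) \<phi>.
        J \<in> V \<and> (\<forall>h\<in>V. B J h = (\<Sum>e'\<in>insert e E. B J e' * B e' h))"
      using extend[of _ "insert e E"] E(3) eV' by blast
    moreover have "\<forall>e1\<in>insert e E. \<forall>e2\<in>insert e E. B e1 e2 = (if e1 = e2 then 1 else 0)"
      using on ee eE notin by auto
    moreover have "finite (insert e E)" "card (insert e E) \<le> Suc m" using E notin by auto
    moreover have "insert e E \<subseteq> fun_span (Suc m) \<phi> \<inter> V"
      using E(3) e_span eV' fun_span_mono_Suc[of m \<phi>] by blast
    ultimately show ?thesis by blast
  qed
qed

section \<open>Martingales with a deterministic bracket\<close>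

text \<open>A martingale increment is orthogonal to the past. In this form the conditional expectation
  disappears from the moment computations below.\<close>

lemma martingale_increment_orthogonal:
  assumes P: "prob_space P" and M: "is_martingale P F T M"
    and st: "0 \<le> s" "s \<le> t" "t \<le> T"
    and Y: "Y \<in> borel_measurable (F s)"
    and int: "integrable P (\<lambda>\<omega>. Y \<omega> * M t \<omega>)"
  shows "(\<integral>\<omega>. Y \<omega> * M t \<omega> \<partial>P) = (\<integral>\<omega>. Y \<omega> * M s \<omega> \<partial>P)"
proof -
  interpret prob_space P by (rule P)
  have s: "s \<in> {0..T}" and t: "t \<in> {s..T}" and t0: "t \<in> {0..T}" using st by auto
  have sub: "subalgebra P (F s)"
    using M s by (simp add: is_martingale_def is_filtration_def)
  interpret finite_measure_subalgebra P "F s" by unfold_locales (rule sub)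
  have Mt: "integrable P (M t)" and Ms: "integrable P (M s)"
    and cond: "AE \<omega> in P. real_cond_exp P (F s) (M t) \<omega> = M s \<omega>"
    using M s t t0 by (auto simp: is_martingale_def)
  have [measurable]: "Y \<in> borel_measurable P"
    using measurable_from_subalg[OF sub Y] .
  have "(\<integral>\<omega>. Y \<omega> * M t \<omega> \<partial>P) = (\<integral>\<omega>. Y \<omega> * real_cond_exp P (F s) (M t) \<omega> \<partial>P)"
    using real_cond_exp_intg(2)[OF int Y borel_measurable_integrable[OF Mt]] ..
  also have "\<dots> = (\<integral>\<omega>. Y \<omega> * M s \<omega> \<partial>P)"
    using cond borel_measurable_integrable[OF Ms]
      measurable_from_subalg[OF sub borel_measurable_cond_exp]
    by (intro integral_cong_AE) auto
  finally show ?thesis .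
qed

lemma martingale_measurable:
  assumes "is_martingale P F T M" "t \<in> {0..T}"
  shows "M t \<in> borel_measurable (F t)" "M t \<in> borel_measurable P"
  using assms by (auto simp: is_martingale_def)

lemma filtration_measurable_mono:
  assumes "is_filtration P T F" "0 \<le> s" "s \<le> t" "t \<le> T" "f \<in> borel_measurable (F s)"
  shows "f \<in> borel_measurable (F t)"
proof (rule measurable_from_subalg[OF _ assms(5)])
  show "subalgebra (F t) (F s)"
    using assms(1-4) unfolding is_filtration_def subalgebra_def by force
qed

lemma filtration_measurable:
  assumes "is_filtration P T F" "t \<in> {0..T}" "f \<in> borel_measurable (F t)"
  shows "f \<in> borel_measurable P"
  using assms measurable_from_subalg unfolding is_filtration_def by blast

lemma square_integrable_mult:
  fixes f g :: "'a \<Rightarrow> real"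
  assumes [measurable]: "f \<in> borel_measurable P" "g \<in> borel_measurable P"
    and "integrable P (\<lambda>x. (f x)\<^sup>2)" "integrable P (\<lambda>x. (g x)\<^sup>2)"
  shows "integrable P (\<lambda>x. f x * g x)"
proof (rule Bochner_Integration.integrable_bound)
  show "integrable P (\<lambda>x. (f x)\<^sup>2 + (g x)\<^sup>2)" using assms by auto
  show "AE x in P. norm (f x * g x) \<le> norm ((f x)\<^sup>2 + (g x)\<^sup>2)"
    using abs_mult_le_sum_squares by simp
qed simp

lemma square_integrable_add:
  fixes f g :: "'a \<Rightarrow> real"
  assumes "f \<in> borel_measurable P" "g \<in> borel_measurable P"
    and "integrable P (\<lambda>x. (f x)\<^sup>2)" "integrable P (\<lambda>x. (g x)\<^sup>2)"
  shows "integrable P (\<lambda>x. (f x + g x)\<^sup>2)"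
  unfolding power2_sum using square_integrable_mult[OF assms] assms
  by (auto simp: mult.assoc)

lemma bounded_mult_integrable:
  fixes f g :: "'a \<Rightarrow> real"
  assumes [measurable]: "f \<in> borel_measurable P" and g: "integrable P g"
    and C: "AE x in P. \<bar>f x\<bar> \<le> C"
  shows "integrable P (\<lambda>x. f x * g x)"
proof (rule Bochner_Integration.integrable_bound)
  show "integrable P (\<lambda>x. C * g x)" using g by simp
  have [measurable]: "g \<in> borel_measurable P" using g by simp
  show "(\<lambda>x. f x * g x) \<in> borel_measurable P" by simp
  show "AE x in P. norm (f x * g x) \<le> norm (C * g x)"
    using C by eventually_elim (auto simp: abs_mult intro!: mult_right_mono)
qed

text \<open>These two martingale properties carry the Ito isometry, and both are inherited by every
  process with the law of \<open>M\<close> (see \<open>martingale_same_law\<close>).\<close>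

definition has_deterministic_bracket ::
  "'a measure \<Rightarrow> (real \<Rightarrow> 'a measure) \<Rightarrow> real \<Rightarrow> (real \<Rightarrow> 'a \<Rightarrow> real) \<Rightarrow> (real \<Rightarrow> real) \<Rightarrow> bool" where
  "has_deterministic_bracket P F T M q \<longleftrightarrow>
     is_martingale P F T M \<and> is_martingale P F T (\<lambda>t \<omega>. (M t \<omega>)\<^sup>2 - q t)"

lemma deterministic_bracket_square_integrable:
  assumes "prob_space P" "has_deterministic_bracket P F T M q" "t \<in> {0..T}"
  shows "integrable P (\<lambda>\<omega>. (M t \<omega>)\<^sup>2)"
proof -
  interpret prob_space P by fact
  have "integrable P (\<lambda>\<omega>. ((M t \<omega>)\<^sup>2 - q t) + q t)"
    using assms by (intro Bochner_Integration.integrable_add)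
      (auto simp: has_deterministic_bracket_def is_martingale_def)
  then show ?thesis by simp
qed

text \<open>The one-step Ito isometry. Writing
  \<open>(M t - M s)\<^sup>2 = (M t)\<^sup>2 + (M s)\<^sup>2 - 2 M s M t\<close>, the orthogonality of increments turns the cross
  term into \<open>2 (M s)\<^sup>2\<close>, and \<open>M\<^sup>2 - q\<close> being a martingale converts the rest to \<open>q t - q s\<close>.
  It matters that \<open>q\<close> is deterministic: it leaves the expectation as a factor.\<close>

lemma deterministic_bracket_increment:
  assumes P: "prob_space P" and M: "has_deterministic_bracket P F T M q"
    and st: "0 \<le> s" "s \<le> t" "t \<le> T"
    and Y: "Y \<in> borel_measurable (F s)" and C: "\<And>\<omega>. \<omega> \<in> space P \<Longrightarrow> \<bar>Y \<omega>\<bar> \<le> C"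
  shows "integrable P (\<lambda>\<omega>. (Y \<omega> * (M t \<omega> - M s \<omega>))\<^sup>2)"
    and "(\<integral>\<omega>. (Y \<omega> * (M t \<omega> - M s \<omega>))\<^sup>2 \<partial>P) = (q t - q s) * (\<integral>\<omega>. (Y \<omega>)\<^sup>2 \<partial>P)"
    and "(\<integral>\<omega>. Y \<omega> * (M t \<omega> - M s \<omega>) \<partial>P) = 0"
proof -
  interpret prob_space P by (rule P)
  have mart: "is_martingale P F T M" "is_martingale P F T (\<lambda>t \<omega>. (M t \<omega>)\<^sup>2 - q t)"
    using M by (auto simp: has_deterministic_bracket_def)
  have filt: "is_filtration P T F" using mart by (simp add: is_martingale_def)
  have s: "s \<in> {0..T}" and t: "t \<in> {0..T}" using st by auto
  have [measurable]: "M s \<in> borel_measurable P" "M t \<in> borel_measurable P"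
    "Y \<in> borel_measurable P"
    using martingale_measurable(2)[OF mart(1)] s t filtration_measurable[OF filt s Y] by auto
  have M2: "integrable P (\<lambda>\<omega>. (M s \<omega>)\<^sup>2)" "integrable P (\<lambda>\<omega>. (M t \<omega>)\<^sup>2)"
    using deterministic_bracket_square_integrable[OF P M] s t by auto
  have M1: "integrable P (M s)" "integrable P (M t)"
    using mart(1) s t by (auto simp: is_martingale_def)
  have st2: "integrable P (\<lambda>\<omega>. M s \<omega> * M t \<omega>)"
    by (intro square_integrable_mult M2) auto
  have bY2: "AE \<omega> in P. \<bar>(Y \<omega>)\<^sup>2\<bar> \<le> C\<^sup>2"
    using power_mono[OF C abs_ge_zero, of _ 2] by (intro AE_I2) simp
  have bY: "AE \<omega> in P. \<bar>Y \<omega>\<bar> \<le> C" using C by auto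
  have Y2: "integrable P (\<lambda>\<omega>. (Y \<omega>)\<^sup>2)"
    by (rule integrable_const_bound[where B = "C\<^sup>2"]) (use bY2 in auto)
  note bnd = bounded_mult_integrable[OF _ _ bY2]
  have I: "integrable P (\<lambda>\<omega>. (Y \<omega>)\<^sup>2 * (M t \<omega>)\<^sup>2)" "integrable P (\<lambda>\<omega>. (Y \<omega>)\<^sup>2 * (M s \<omega>)\<^sup>2)"
    "integrable P (\<lambda>\<omega>. (Y \<omega>)\<^sup>2 * (M s \<omega> * M t \<omega>))"
    by (auto intro!: bnd M2 st2)
  have sq: "(\<lambda>\<omega>. (Y \<omega> * (M t \<omega> - M s \<omega>))\<^sup>2)
      = (\<lambda>\<omega>. (Y \<omega>)\<^sup>2 * (M t \<omega>)\<^sup>2 + (Y \<omega>)\<^sup>2 * (M s \<omega>)\<^sup>2 - 2 * ((Y \<omega>)\<^sup>2 * (M s \<omega> * M t \<omega>)))"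
    by (auto simp: power2_eq_square algebra_simps)
  show "integrable P (\<lambda>\<omega>. (Y \<omega> * (M t \<omega> - M s \<omega>))\<^sup>2)"
    unfolding sq using I by auto
  have Ms[measurable]: "M s \<in> borel_measurable (F s)" "Y \<in> borel_measurable (F s)"
    using martingale_measurable(1)[OF mart(1) s] Y by auto
  have cross: "(\<integral>\<omega>. (Y \<omega>)\<^sup>2 * (M s \<omega> * M t \<omega>) \<partial>P) = (\<integral>\<omega>. (Y \<omega>)\<^sup>2 * (M s \<omega>)\<^sup>2 \<partial>P)"
  proof -
    have "(\<integral>\<omega>. ((Y \<omega>)\<^sup>2 * M s \<omega>) * M t \<omega> \<partial>P) = (\<integral>\<omega>. ((Y \<omega>)\<^sup>2 * M s \<omega>) * M s \<omega> \<partial>P)"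
      by (rule martingale_increment_orthogonal[OF P mart(1) st])
        (use I(3) in \<open>auto simp: mult.assoc\<close>)
    then show ?thesis by (simp add: mult.assoc power2_eq_square)
  qed
  have "(\<integral>\<omega>. (Y \<omega>)\<^sup>2 * ((M t \<omega>)\<^sup>2 - q t) \<partial>P) = (\<integral>\<omega>. (Y \<omega>)\<^sup>2 * ((M s \<omega>)\<^sup>2 - q s) \<partial>P)"
    by (rule martingale_increment_orthogonal[OF P mart(2) st])
      (use I(1) Y2 in \<open>auto simp: right_diff_distrib\<close>)
  then have "(\<integral>\<omega>. (Y \<omega>)\<^sup>2 * (M t \<omega>)\<^sup>2 \<partial>P) - (\<integral>\<omega>. (Y \<omega>)\<^sup>2 * (M s \<omega>)\<^sup>2 \<partial>P)
      = (q t - q s) * (\<integral>\<omega>. (Y \<omega>)\<^sup>2 \<partial>P)"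
    using I Y2 by (simp add: right_diff_distrib left_diff_distrib algebra_simps)
  then show "(\<integral>\<omega>. (Y \<omega> * (M t \<omega> - M s \<omega>))\<^sup>2 \<partial>P) = (q t - q s) * (\<integral>\<omega>. (Y \<omega>)\<^sup>2 \<partial>P)"
    unfolding sq using I cross by simp
  have J: "integrable P (\<lambda>\<omega>. Y \<omega> * M t \<omega>)" "integrable P (\<lambda>\<omega>. Y \<omega> * M s \<omega>)"
    by (auto intro!: bounded_mult_integrable[OF _ _ bY] M1)
  then show "(\<integral>\<omega>. Y \<omega> * (M t \<omega> - M s \<omega>) \<partial>P) = 0"
    using martingale_increment_orthogonal[OF P mart(1) st Y J(1)]
    by (simp add: right_diff_distrib)
qed

lemma simple_predictable_mono:
  assumes "is_simple_predictable P F T n t \<xi>" "i \<le> j" "j \<le> n"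
  shows "t i \<le> t j"
  using assms(2,3)
proof (induction rule: dec_induct)
  case (step j)
  then show ?case using assms(1) unfolding is_simple_predictable_def
    by (metis Suc_le_lessD Suc_leD order_trans)
qed simp

lemma simple_predictable_times:
  assumes simple: "is_simple_predictable P F T n t \<xi>" and "k \<le> n"
  shows "0 \<le> t k \<and> t k \<le> T"
  using simple_predictable_mono[OF simple, of 0 k] simple_predictable_mono[OF simple, of k n] assms
  by (auto simp: is_simple_predictable_def)

lemma simple_predictable_pred:
  assumes "is_simple_predictable P F T (Suc n) t \<xi>"
  shows "is_simple_predictable P F T n t \<xi>"
  using assms simple_predictable_times[OF assms, of n]
  by (auto simp: is_simple_predictable_def)

text \<open>Each new term \<open>\<xi> n (M (t (n+1)) - M (t n))\<close> is orthogonal to the integral accumulated up to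
  time \<open>t n\<close>, so the second moments of the terms add up.\<close>

lemma simple_integral_isometry:
  assumes P: "prob_space P" and M: "has_deterministic_bracket P F T M q"
    and simple: "is_simple_predictable P F T n t \<xi>"
  shows "simple_integral n t \<xi> M \<in> borel_measurable (F (t n))"
    and "integrable P (\<lambda>\<omega>. (simple_integral n t \<xi> M \<omega>)\<^sup>2)"
    and "(\<integral>\<omega>. (simple_integral n t \<xi> M \<omega>)\<^sup>2 \<partial>P)
          = (\<Sum>k<n. (q (t (Suc k)) - q (t k)) * (\<integral>\<omega>. (\<xi> k \<omega>)\<^sup>2 \<partial>P))"
    and "(\<integral>\<omega>. simple_integral n t \<xi> M \<omega> \<partial>P) = 0"
proof -
  interpret prob_space P by (rule P)
  have mart: "is_martingale P F T M" using M by (auto simp: has_deterministic_bracket_def)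
  have filt: "is_filtration P T F" using mart by (simp add: is_martingale_def)
  let ?S = "\<lambda>n. simple_integral n t \<xi> M"
  have "?S n \<in> borel_measurable (F (t n)) \<and>
    integrable P (\<lambda>\<omega>. (?S n \<omega>)\<^sup>2) \<and>
    (\<integral>\<omega>. (?S n \<omega>)\<^sup>2 \<partial>P) = (\<Sum>k<n. (q (t (Suc k)) - q (t k)) * (\<integral>\<omega>. (\<xi> k \<omega>)\<^sup>2 \<partial>P)) \<and>
    (\<integral>\<omega>. ?S n \<omega> \<partial>P) = 0"
    using simple
  proof (induction n)
    case 0
    have "?S 0 = (\<lambda>_. 0)" by (auto simp: simple_integral_def)
    then show ?case by simp
  next
    case (Suc n)
    note IH = Suc.IH[OF simple_predictable_pred[OF Suc.prems]]
    have t: "0 \<le> t n" "t n \<le> t (Suc n)" "t (Suc n) \<le> T"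
      using Suc.prems simple_predictable_times[OF Suc.prems, of n]
        simple_predictable_times[OF Suc.prems, of "Suc n"]
      by (auto simp: is_simple_predictable_def)
    then have tn: "t n \<in> {0..T}" and tn': "t (Suc n) \<in> {0..T}" by auto
    obtain C where \<xi>: "\<xi> n \<in> borel_measurable (F (t n))"
      and C: "\<And>\<omega>. \<omega> \<in> space P \<Longrightarrow> \<bar>\<xi> n \<omega>\<bar> \<le> C"
      using Suc.prems unfolding is_simple_predictable_def by blast
    let ?D = "\<lambda>\<omega>. M (t (Suc n)) \<omega> - M (t n) \<omega>"
    have S_Suc: "?S (Suc n) = (\<lambda>\<omega>. ?S n \<omega> + \<xi> n \<omega> * ?D \<omega>)"
      by (auto simp: simple_integral_def)
    note inc = deterministic_bracket_increment[OF P M t \<xi> C]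
    have Sn: "?S n \<in> borel_measurable (F (t n))" "integrable P (\<lambda>\<omega>. (?S n \<omega>)\<^sup>2)"
      using IH by auto
    note meas[measurable] = martingale_measurable(2)[OF mart tn] martingale_measurable(2)[OF mart tn']
      filtration_measurable[OF filt tn \<xi>] filtration_measurable[OF filt tn Sn(1)]
    have int_cross: "integrable P (\<lambda>\<omega>. ?S n \<omega> * (\<xi> n \<omega> * ?D \<omega>))"
      by (rule square_integrable_mult) (use Sn inc(1) in auto)
    have S\<xi>: "(\<lambda>\<omega>. ?S n \<omega> * \<xi> n \<omega>) \<in> borel_measurable (F (t n))"
      using Sn(1) \<xi> by (rule borel_measurable_times)
    have int1: "integrable P (\<lambda>\<omega>. ?S n \<omega> * M r \<omega>)" if "r \<in> {0..T}" for r
      using martingale_measurable(2)[OF mart that]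
      by (intro square_integrable_mult Sn deterministic_bracket_square_integrable[OF P M that]) auto
    have int2: "integrable P (\<lambda>\<omega>. (?S n \<omega> * \<xi> n \<omega>) * M r \<omega>)" if "r \<in> {0..T}" for r
      using bounded_mult_integrable[OF _ int1[OF that], of "\<xi> n" C] C
      by (simp add: ac_simps)
    have "(\<integral>\<omega>. (?S n \<omega> * \<xi> n \<omega>) * M (t (Suc n)) \<omega> \<partial>P) = (\<integral>\<omega>. (?S n \<omega> * \<xi> n \<omega>) * M (t n) \<omega> \<partial>P)"
      by (rule martingale_increment_orthogonal[OF P mart t S\<xi> int2[OF tn']])
    then have cross: "(\<integral>\<omega>. ?S n \<omega> * (\<xi> n \<omega> * ?D \<omega>) \<partial>P) = 0"
      using int2[OF tn] int2[OF tn'] by (simp add: right_diff_distrib mult.assoc)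
    have "?S (Suc n) \<in> borel_measurable (F (t (Suc n)))"
    proof -
      have "?S n \<in> borel_measurable (F (t (Suc n)))" "\<xi> n \<in> borel_measurable (F (t (Suc n)))"
        "M (t n) \<in> borel_measurable (F (t (Suc n)))" "M (t (Suc n)) \<in> borel_measurable (F (t (Suc n)))"
        using filtration_measurable_mono[OF filt t] Sn \<xi> martingale_measurable(1)[OF mart] tn tn'
        by auto
      then show ?thesis unfolding S_Suc by measurable
    qed
    moreover have "integrable P (\<lambda>\<omega>. (?S (Suc n) \<omega>)\<^sup>2)"
      unfolding S_Suc by (rule square_integrable_add) (use Sn inc(1) in auto)
    moreover have "(\<integral>\<omega>. (?S (Suc n) \<omega>)\<^sup>2 \<partial>P)
        = (\<Sum>k<Suc n. (q (t (Suc k)) - q (t k)) * (\<integral>\<omega>. (\<xi> k \<omega>)\<^sup>2 \<partial>P))"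
    proof -
      have "(\<integral>\<omega>. (?S (Suc n) \<omega>)\<^sup>2 \<partial>P)
          = (\<integral>\<omega>. (?S n \<omega>)\<^sup>2 + (\<xi> n \<omega> * ?D \<omega>)\<^sup>2 + 2 * (?S n \<omega> * (\<xi> n \<omega> * ?D \<omega>)) \<partial>P)"
        unfolding S_Suc power2_sum by (simp add: mult.assoc)
      also have "\<dots> = (\<integral>\<omega>. (?S n \<omega>)\<^sup>2 \<partial>P) + (\<integral>\<omega>. (\<xi> n \<omega> * ?D \<omega>)\<^sup>2 \<partial>P)"
        using Sn inc(1) int_cross cross by simp
      finally show ?thesis using IH inc(2) by simp
    qed
    moreover have "(\<integral>\<omega>. ?S (Suc n) \<omega> \<partial>P) = 0"
    proof -
      have "integrable P (?S n)"
        by (rule square_integrable_imp_integrable) (use Sn in auto)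
      moreover have "integrable P (\<lambda>\<omega>. \<xi> n \<omega> * ?D \<omega>)"
        by (rule square_integrable_imp_integrable) (use inc(1) in auto)
      ultimately show ?thesis unfolding S_Suc using IH inc(3) by simp
    qed
    ultimately show ?case by blast
  qed
  then show "?S n \<in> borel_measurable (F (t n))" "integrable P (\<lambda>\<omega>. (?S n \<omega>)\<^sup>2)"
    "(\<integral>\<omega>. (?S n \<omega>)\<^sup>2 \<partial>P) = (\<Sum>k<n. (q (t (Suc k)) - q (t k)) * (\<integral>\<omega>. (\<xi> k \<omega>)\<^sup>2 \<partial>P))"
    "(\<integral>\<omega>. ?S n \<omega> \<partial>P) = 0"
    by auto
qed

section \<open>Uniqueness of the bracket\<close>

text \<open>The amount by which \<open>exp (-x)\<close> lies above its tangent. For a convex \<open>\<Phi>\<close> the gap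
  \<open>\<Phi> y - \<Phi> x - \<Phi>' x (y - x)\<close> is at most \<open>(\<Phi>' y - \<Phi>' x) (y - x)\<close>, by nonnegativity of the gap with
  \<open>x\<close> and \<open>y\<close> exchanged. The upper bound is linear in \<open>\<bar>y - x\<bar>\<close> with a factor that is both bounded
  (for arguments bounded below) and small for close arguments.\<close>

lemma exp_tangent_gap:
  fixes x y :: real
  shows "0 \<le> exp (-y) - exp (-x) + exp (-x) * (y - x)"
    and "exp (-y) - exp (-x) + exp (-x) * (y - x) \<le> \<bar>y - x\<bar> * \<bar>exp (-y) - exp (-x)\<bar>"
proof -
  have gap: "0 \<le> exp (-v) - exp (-u) + exp (-u) * (v - u)" for u v :: real
  proof -
    have "exp (-v) = exp (-u) * exp (u - v)" by (simp flip: exp_add)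
    moreover have "exp (-u) * (1 + (u - v)) \<le> exp (-u) * exp (u - v)"
      by (intro mult_left_mono exp_ge_add_one_self) auto
    ultimately show ?thesis by (simp add: algebra_simps)
  qed
  show "0 \<le> exp (-y) - exp (-x) + exp (-x) * (y - x)" by (rule gap)
  have "exp (-y) - exp (-x) + exp (-x) * (y - x) \<le> (y - x) * (exp (-x) - exp (-y))"
    using gap[of x y] by (simp add: algebra_simps)
  also have "\<dots> \<le> \<bar>(y - x) * (exp (-x) - exp (-y))\<bar>" by simp
  finally show "exp (-y) - exp (-x) + exp (-x) * (y - x) \<le> \<bar>y - x\<bar> * \<bar>exp (-y) - exp (-x)\<bar>"
    by (simp add: abs_mult abs_minus_commute)
qed

lemma exp_tangent_gap_zero:
  fixes x :: real
  assumes "exp (-x) - 1 + x = 0"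
  shows "x = 0"
  using exp_minus_greater[of x] assms by (cases "x = 0") auto

lemma equidistant_oscillation_tendsto_0:
  fixes f :: "real \<Rightarrow> real"
  assumes f: "continuous_on {0..T} f" and "0 \<le> T" "0 < e"
  shows "\<forall>\<^sub>F n in sequentially. \<forall>k<n. \<bar>f (real (Suc k) * T / real n) - f (real k * T / real n)\<bar> \<le> e"
proof -
  have "uniformly_continuous_on {0..T} f"
    using f by (intro compact_uniformly_continuous) auto
  then obtain d where d: "d > 0"
    "\<And>x y. x \<in> {0..T} \<Longrightarrow> y \<in> {0..T} \<Longrightarrow> dist y x < d \<Longrightarrow> dist (f y) (f x) < e"
    using \<open>0 < e\<close> by (auto simp: uniformly_continuous_on_def)
  have "(\<lambda>n. T / real n) \<longlonglongrightarrow> 0" by (rule lim_const_over_n)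
  then have "\<forall>\<^sub>F n in sequentially. T / real n < d"
    using d(1) by (rule order_tendstoD)
  then show ?thesis
  proof (rule eventually_mono, intro allI impI)
    fix n k assume n: "T / real n < d" and k: "k < n"
    have "real j * T / real n \<in> {0..T}" if "j \<le> n" for j
      using that k \<open>0 \<le> T\<close> mult_right_mono[of "real j" "real n" T] by (auto simp: field_simps)
    moreover have "dist (real (Suc k) * T / real n) (real k * T / real n) < d"
      using n \<open>0 \<le> T\<close> by (simp add: dist_real_def diff_divide_distrib[symmetric] algebra_simps)
    ultimately have "dist (f (real (Suc k) * T / real n)) (f (real k * T / real n)) < e"
      using k by (intro d(2)) (simp_all del: of_nat_Suc)
    then show "\<bar>f (real (Suc k) * T / real n) - f (real k * T / real n)\<bar> \<le> e"
      by (simp add: dist_real_def)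
  qed
qed

text \<open>Along a partition, the second order terms of a function of bounded variation \<open>x = a - q\<close>
  are controlled by its total variation, at most \<open>a t + q t\<close>, times the largest oscillation of
  \<open>exp (-x)\<close> over one cell.\<close>

lemma tangent_gap_sum_bound:
  fixes a q :: "real \<Rightarrow> real"
  assumes a: "mono_on {0..t} a" "a 0 = 0" and q: "mono_on {0..t} q" "q 0 = 0"
    and "0 \<le> t" and n: "0 < n"
    and x: "\<And>s. x s = a s - q s" and t: "\<And>k. \<tau> k = real k * t / real n"
    and e: "\<And>k. k < n \<Longrightarrow> \<bar>exp (- x (\<tau> (Suc k))) - exp (- x (\<tau> k))\<bar> \<le> e"
  shows "\<bar>\<Sum>k<n. exp (- x (\<tau> (Suc k))) - exp (- x (\<tau> k)) + exp (- x (\<tau> k)) * (x (\<tau> (Suc k)) - x (\<tau> k))\<bar>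
    \<le> e * (a t + q t)"
proof -
  have in_T: "\<tau> j \<in> {0..t}" if "j \<le> n" for j
    using that n \<open>0 \<le> t\<close> mult_right_mono[of "real j" "real n" t]
    by (auto simp: t field_simps)
  have le: "\<tau> k \<le> \<tau> (Suc k)" for k
    using n \<open>0 \<le> t\<close> by (auto simp: t intro!: divide_right_mono mult_right_mono)
  have ends: "\<tau> 0 = 0" "\<tau> n = t" using n by (auto simp: t)
  have e0: "0 \<le> e" using e[OF n] by linarith
  have "\<bar>\<Sum>k<n. exp (- x (\<tau> (Suc k))) - exp (- x (\<tau> k)) + exp (- x (\<tau> k)) * (x (\<tau> (Suc k)) - x (\<tau> k))\<bar>
    \<le> (\<Sum>k<n. e * ((a (\<tau> (Suc k)) - a (\<tau> k)) + (q (\<tau> (Suc k)) - q (\<tau> k))))"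
  proof (rule order_trans[OF sum_abs], rule sum_mono)
    fix k assume "k \<in> {..<n}"
    then have k: "\<tau> k \<in> {0..t}" "\<tau> (Suc k) \<in> {0..t}" "k < n" using in_T by auto
    have "a (\<tau> k) \<le> a (\<tau> (Suc k))" "q (\<tau> k) \<le> q (\<tau> (Suc k))"
      using a(1) q(1) k le[of k] by (auto simp: mono_on_def)
    then have "\<bar>x (\<tau> (Suc k)) - x (\<tau> k)\<bar>
        \<le> (a (\<tau> (Suc k)) - a (\<tau> k)) + (q (\<tau> (Suc k)) - q (\<tau> k))"
      unfolding x by linarith
    then have "\<bar>x (\<tau> (Suc k)) - x (\<tau> k)\<bar> * \<bar>exp (- x (\<tau> (Suc k))) - exp (- x (\<tau> k))\<bar>
        \<le> ((a (\<tau> (Suc k)) - a (\<tau> k)) + (q (\<tau> (Suc k)) - q (\<tau> k))) * e"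
      using e[OF k(3)] by (intro mult_mono) auto
    then show "\<bar>exp (- x (\<tau> (Suc k))) - exp (- x (\<tau> k)) + exp (- x (\<tau> k)) * (x (\<tau> (Suc k)) - x (\<tau> k))\<bar>
        \<le> e * ((a (\<tau> (Suc k)) - a (\<tau> k)) + (q (\<tau> (Suc k)) - q (\<tau> k)))"
      using exp_tangent_gap[of "x (\<tau> (Suc k))" "x (\<tau> k)"] by (simp add: mult.commute)
  qed
  also have "\<dots> = e * (a t + q t)"
    by (simp add: sum_distrib_left[symmetric] sum.distrib sum_lessThan_telescope ends a(2) q(2)
        sum_lessThan_telescope[of "\<lambda>k. a (\<tau> k)"] sum_lessThan_telescope[of "\<lambda>k. q (\<tau> k)"])
  finally show ?thesis .
qed

text \<open>The difference \<open>X = A - q\<close> is a martingale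
  with continuous paths of bounded variation and is bounded below by \<open>-q T\<close>, so \<open>exp (-X)\<close> is
  bounded. Telescoping \<open>exp (-X t) - 1\<close> along a partition, the first order terms have expectation
  zero and the tangent gaps vanish in the limit by dominated convergence with dominating
  variable \<open>exp (q T) (A t + q t)\<close>. Hence \<open>exp (-X t)\<close> has expectation \<open>1\<close> while
  \<open>X t\<close> has expectation \<open>0\<close>: this is the case of equality in Jensen's inequality, and
  \<open>X t = 0\<close> by strict convexity.\<close>

lemma deterministic_bracket_unique:
  assumes P: "prob_space P" and M: "has_deterministic_bracket P F T M q"
    and q: "q 0 = 0" "mono_on {0..T} q" "continuous_on {0..T} q"
    and A: "is_quadratic_variation P F T M A" and t: "t \<in> {0..T}"
  shows "AE \<omega> in P. A t \<omega> = q t"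
proof -
  interpret prob_space P by (rule P)
  define X where "X s \<omega> = A s \<omega> - q s" for s \<omega>
  have mart: "is_martingale P F T (\<lambda>t \<omega>. (M t \<omega>)\<^sup>2 - q t)"
    "is_martingale P F T (\<lambda>t \<omega>. (M t \<omega>)\<^sup>2 - A t \<omega>)"
    using M A by (auto simp: has_deterministic_bracket_def is_quadratic_variation_def)
  have filt: "is_filtration P T F" using mart by (simp add: is_martingale_def)
  have A_reg: "AE \<omega> in P. A 0 \<omega> = 0 \<and> mono_on {0..T} (\<lambda>t. A t \<omega>) \<and> continuous_on {0..T} (\<lambda>t. A t \<omega>)"
    using A by (simp add: is_quadratic_variation_def)
  have AF: "A s \<in> borel_measurable (F s)" if "s \<in> {0..T}" for s
    using A that by (simp add: is_quadratic_variation_def)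
  have AP: "A s \<in> borel_measurable P" if "s \<in> {0..T}" for s
    using filtration_measurable[OF filt that AF[OF that]] .
  have X_diff: "X s \<omega> = ((M s \<omega>)\<^sup>2 - q s) - ((M s \<omega>)\<^sup>2 - A s \<omega>)" for s \<omega>
    by (simp add: X_def)
  have X_meas: "X s \<in> borel_measurable (F s)" "X s \<in> borel_measurable P" if "s \<in> {0..T}" for s
    using AF[OF that] AP[OF that] unfolding X_def by measurable
  have X_int: "integrable P (X s)" if "s \<in> {0..T}" for s
  proof -
    have "integrable P (\<lambda>\<omega>. (M s \<omega>)\<^sup>2 - q s)" "integrable P (\<lambda>\<omega>. (M s \<omega>)\<^sup>2 - A s \<omega>)"
      using mart that unfolding is_martingale_def by blast+
    from Bochner_Integration.integrable_diff[OF this] show ?thesis by (simp add: X_def[abs_def])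
  qed
  have A_int: "integrable P (A s)" if "s \<in> {0..T}" for s
    using Bochner_Integration.integrable_add[OF X_int[OF that], of "\<lambda>_. q s"] by (simp add: X_def)
  have X_lower: "AE \<omega> in P. \<bar>exp (- X s \<omega>)\<bar> \<le> exp (q T)" if "s \<in> {0..T}" for s
    using A_reg
  proof eventually_elim
    case (elim \<omega>)
    then have "A 0 \<omega> \<le> A s \<omega>" using that mono_onD[of _ "\<lambda>t. A t \<omega>" 0 s] by auto
    moreover have "q s \<le> q T" using mono_onD[OF q(2), of s T] that by auto
    ultimately show ?case using elim by (simp add: X_def)
  qed
  have U_int: "integrable P (\<lambda>\<omega>. exp (- X s \<omega>))" if "s \<in> {0..T}" for s
    using X_lower[OF that] X_meas(2)[OF that] by (intro integrable_const_bound[where B = "exp (q T)"]) auto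
  have UX_int: "integrable P (\<lambda>\<omega>. exp (- X s \<omega>) * X r \<omega>)" if "s \<in> {0..T}" "r \<in> {0..T}" for s r
    using X_meas(2)[OF that(1)]
    by (intro bounded_mult_integrable[OF _ X_int[OF that(2)] X_lower[OF that(1)]]) auto
  have orth: "(\<integral>\<omega>. exp (- X s \<omega>) * (X r \<omega> - X s \<omega>) \<partial>P) = 0" if sr: "0 \<le> s" "s \<le> r" "r \<le> T" for s r
  proof -
    have s: "s \<in> {0..T}" and r: "r \<in> {0..T}" using sr by auto
    have Y: "(\<lambda>\<omega>. exp (- X s \<omega>)) \<in> borel_measurable (F s)" using X_meas(1)[OF s] by measurable
    have YP: "(\<lambda>\<omega>. exp (- X s \<omega>)) \<in> borel_measurable P" using X_meas(2)[OF s] by measurable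
    have I: "integrable P (\<lambda>\<omega>. exp (- X s \<omega>) * ((M r' \<omega>)\<^sup>2 - q r'))"
      "integrable P (\<lambda>\<omega>. exp (- X s \<omega>) * ((M r' \<omega>)\<^sup>2 - A r' \<omega>))" if "r' \<in> {0..T}" for r'
      using mart that
      by (auto intro!: bounded_mult_integrable[OF YP _ X_lower[OF s]] simp: is_martingale_def)
    have eq: "(\<integral>\<omega>. exp (- X s \<omega>) * X r' \<omega> \<partial>P) = (\<integral>\<omega>. exp (- X s \<omega>) * ((M r' \<omega>)\<^sup>2 - q r') \<partial>P)
        - (\<integral>\<omega>. exp (- X s \<omega>) * ((M r' \<omega>)\<^sup>2 - A r' \<omega>) \<partial>P)" if "r' \<in> {0..T}" for r'
      unfolding Bochner_Integration.integral_diff[OF I[OF that], symmetric]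
      by (intro Bochner_Integration.integral_cong refl) (simp add: X_diff algebra_simps)
    have "(\<integral>\<omega>. exp (- X s \<omega>) * X r \<omega> \<partial>P) = (\<integral>\<omega>. exp (- X s \<omega>) * X s \<omega> \<partial>P)"
      unfolding eq[OF r] eq[OF s]
      using martingale_increment_orthogonal[OF P mart(1) sr Y I(1)[OF r]]
        martingale_increment_orthogonal[OF P mart(2) sr Y I(2)[OF r]] by simp
    then show ?thesis using UX_int[OF s r] UX_int[OF s s] by (simp add: right_diff_distrib)
  qed
  have t0: "0 \<le> t" "t \<le> T" using t by auto
  \<comment> \<open>\<open>R n\<close> collects the tangent gaps along the partition of \<open>[0,t]\<close> in \<open>n\<close> equal cells.\<close>
  define \<tau> where "\<tau> n k = real k * t / real n" for n k :: nat
  define R where "R n \<omega> = (\<Sum>k<n. exp (- X (\<tau> n (Suc k)) \<omega>) - exp (- X (\<tau> n k) \<omega>)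
      + exp (- X (\<tau> n k) \<omega>) * (X (\<tau> n (Suc k)) \<omega> - X (\<tau> n k) \<omega>))" for n \<omega>
  have \<tau>_in: "\<tau> n k \<in> {0..T}" if "k \<le> n" "0 < n" for n k
  proof -
    have "real k * t \<le> real n * t" using that t0 by (intro mult_right_mono) auto
    then have "\<tau> n k \<le> t" using that by (simp add: \<tau>_def field_simps)
    then show ?thesis using t0 by (auto simp: \<tau>_def)
  qed
  have \<tau>_le: "\<tau> n k \<le> \<tau> n (Suc k)" for n k
    using t0 by (auto simp: \<tau>_def intro!: divide_right_mono mult_right_mono)
  have X0: "AE \<omega> in P. X 0 \<omega> = 0" using A_reg q(1) by (auto simp: X_def)
  have R_int: "(\<integral>\<omega>. R n \<omega> \<partial>P) = (\<integral>\<omega>. exp (- X t \<omega>) \<partial>P) - 1" if n: "0 < n" for n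
  proof -
    have "(\<integral>\<omega>. R n \<omega> \<partial>P) = (\<Sum>k<n. \<integral>\<omega>. exp (- X (\<tau> n (Suc k)) \<omega>) - exp (- X (\<tau> n k) \<omega>)
      + exp (- X (\<tau> n k) \<omega>) * (X (\<tau> n (Suc k)) \<omega> - X (\<tau> n k) \<omega>) \<partial>P)"
      unfolding R_def
    proof (rule Bochner_Integration.integral_sum)
      fix k assume "k \<in> {..<n}"
      then have k: "\<tau> n k \<in> {0..T}" "\<tau> n (Suc k) \<in> {0..T}" using \<tau>_in n by auto
      show "integrable P (\<lambda>\<omega>. exp (- X (\<tau> n (Suc k)) \<omega>) - exp (- X (\<tau> n k) \<omega>)
        + exp (- X (\<tau> n k) \<omega>) * (X (\<tau> n (Suc k)) \<omega> - X (\<tau> n k) \<omega>))"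
        unfolding right_diff_distrib
        by (rule Bochner_Integration.integrable_add Bochner_Integration.integrable_diff U_int UX_int k)+
    qed
    also have "\<dots> = (\<Sum>k<n. (\<integral>\<omega>. exp (- X (\<tau> n (Suc k)) \<omega>) \<partial>P) - (\<integral>\<omega>. exp (- X (\<tau> n k) \<omega>) \<partial>P))"
    proof (rule sum.cong[OF refl])
      fix k assume "k \<in> {..<n}"
      then have k: "\<tau> n k \<in> {0..T}" "\<tau> n (Suc k) \<in> {0..T}" using \<tau>_in n by auto
      have "integrable P (\<lambda>\<omega>. exp (- X (\<tau> n k) \<omega>) * (X (\<tau> n (Suc k)) \<omega> - X (\<tau> n k) \<omega>))"
        unfolding right_diff_distrib using UX_int k by auto
      then show "(\<integral>\<omega>. exp (- X (\<tau> n (Suc k)) \<omega>) - exp (- X (\<tau> n k) \<omega>)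
        + exp (- X (\<tau> n k) \<omega>) * (X (\<tau> n (Suc k)) \<omega> - X (\<tau> n k) \<omega>) \<partial>P)
        = (\<integral>\<omega>. exp (- X (\<tau> n (Suc k)) \<omega>) \<partial>P) - (\<integral>\<omega>. exp (- X (\<tau> n k) \<omega>) \<partial>P)"
        using U_int[OF k(1)] U_int[OF k(2)] orth[of "\<tau> n k" "\<tau> n (Suc k)"] k \<tau>_le[of n k] by simp
    qed
    also have "\<dots> = (\<integral>\<omega>. exp (- X t \<omega>) \<partial>P) - (\<integral>\<omega>. exp (- X 0 \<omega>) \<partial>P)"
      using n sum_lessThan_telescope[of "\<lambda>k. \<integral>\<omega>. exp (- X (\<tau> n k) \<omega>) \<partial>P" n] by (simp add: \<tau>_def)
    also have "(\<integral>\<omega>. exp (- X 0 \<omega>) \<partial>P) = (\<integral>\<omega>. 1 \<partial>P)"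
      using X0 X_meas(2)[of 0] t0 by (intro integral_cong_AE) auto
    finally show ?thesis by (simp add: prob_space)
  qed
  have mono_t: "mono_on {0..t} f" if "mono_on {0..T} f" for f :: "real \<Rightarrow> real"
    using that t0 by (auto simp: mono_on_def)
  have bound: "\<bar>R n \<omega>\<bar> \<le> e * (A t \<omega> + q t)"
    if "0 < n" "A 0 \<omega> = 0" "mono_on {0..T} (\<lambda>t. A t \<omega>)"
      "\<And>k. k < n \<Longrightarrow> \<bar>exp (- X (\<tau> n (Suc k)) \<omega>) - exp (- X (\<tau> n k) \<omega>)\<bar> \<le> e" for n \<omega> e
    unfolding R_def
    by (rule tangent_gap_sum_bound[of t "\<lambda>t. A t \<omega>" q n "\<lambda>s. X s \<omega>" "\<tau> n"])
      (use that mono_t q t0 in \<open>auto simp: X_def \<tau>_def\<close>)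
  have R_meas: "R n \<in> borel_measurable P" for n
  proof (cases "n = 0")
    case True
    then have "R n = (\<lambda>_. 0)" by (auto simp: R_def)
    then show ?thesis by simp
  next
    case False
    then have [measurable]: "X (\<tau> n k) \<in> borel_measurable P" if "k \<le> n" for k
      using X_meas(2) \<tau>_in that by auto
    show ?thesis unfolding R_def by (intro borel_measurable_sum) auto
  qed
  \<comment> \<open>For \<open>n = 0\<close> there are no cells to telescope over, hence the shift to \<open>Suc n\<close>.\<close>
  have "(\<lambda>n. \<integral>\<omega>. R (Suc n) \<omega> \<partial>P) \<longlonglongrightarrow> (\<integral>\<omega>. 0 \<partial>P)"
  proof (rule integral_dominated_convergence[where w = "\<lambda>\<omega>. exp (q T) * (A t \<omega> + q t)"])
    show "integrable P (\<lambda>\<omega>. exp (q T) * (A t \<omega> + q t))" using A_int[OF t] by auto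
    show "AE \<omega> in P. (\<lambda>n. R (Suc n) \<omega>) \<longlonglongrightarrow> 0"
      using A_reg
    proof eventually_elim
      case (elim \<omega>)
      then have A0: "0 \<le> A t \<omega>" using mono_onD[of _ "\<lambda>t. A t \<omega>" 0 t] t0 by auto
      have q0: "0 \<le> q t" using mono_onD[OF q(2), of 0 t] t0 q(1) by auto
      have cont: "continuous_on {0..t} (\<lambda>s. exp (- X s \<omega>))"
        unfolding X_def using elim q(3) t0
        by (intro continuous_intros) (auto elim: continuous_on_subset)
      have "(\<lambda>n. R n \<omega>) \<longlonglongrightarrow> 0"
      proof (rule LIMSEQ_I)
        fix r :: real assume r: "0 < r"
        define e where "e = r / (2 * (A t \<omega> + q t + 1))"
        have e: "0 < e" using r A0 q0 by (auto simp: e_def)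
        have "e * (A t \<omega> + q t) \<le> e * (A t \<omega> + q t + 1)" using e by (intro mult_left_mono) auto
        also have "\<dots> = r / 2" using A0 q0 by (simp add: e_def field_simps)
        also have "\<dots> < r" using r by simp
        finally have er: "e * (A t \<omega> + q t) < r" .
        have "\<forall>\<^sub>F n in sequentially. \<bar>R n \<omega>\<bar> < r"
          using equidistant_oscillation_tendsto_0[OF cont t0(1) e] eventually_gt_at_top[of 0]
        proof eventually_elim
          case (elim n)
          then show ?case
            using bound[of n \<omega> e] er \<open>A 0 \<omega> = 0 \<and> _\<close> by (simp add: \<tau>_def)
        qed
        then show "\<exists>no. \<forall>n\<ge>no. norm (R n \<omega> - 0) < r" by (simp add: eventually_sequentially)
      qed
      then show ?case by (rule LIMSEQ_Suc)
    qed
    show "AE \<omega> in P. norm (R (Suc n) \<omega>) \<le> exp (q T) * (A t \<omega> + q t)" for n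
    proof -
      have "AE \<omega> in P. \<forall>k\<in>{..Suc n}. \<bar>exp (- X (\<tau> (Suc n) k) \<omega>)\<bar> \<le> exp (q T)"
        using X_lower \<tau>_in by (intro AE_finite_allI) auto
      then show ?thesis using A_reg
      proof eventually_elim
        case (elim \<omega>)
        have "\<bar>exp (- X (\<tau> (Suc n) (Suc k)) \<omega>) - exp (- X (\<tau> (Suc n) k) \<omega>)\<bar> \<le> exp (q T)" if "k < Suc n" for k
        proof -
          have "exp (- X (\<tau> (Suc n) (Suc k)) \<omega>) \<le> exp (q T)" "exp (- X (\<tau> (Suc n) k) \<omega>) \<le> exp (q T)"
            using elim(1) that by auto
          moreover have "0 < exp (- X (\<tau> (Suc n) (Suc k)) \<omega>)" "0 < exp (- X (\<tau> (Suc n) k) \<omega>)" by auto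
          ultimately show ?thesis by linarith
        qed
        then show ?case using bound[of "Suc n" \<omega> "exp (q T)"] elim(2) by auto
      qed
    qed
  qed (use R_meas in auto)
  then have "(\<lambda>n::nat. (\<integral>\<omega>. exp (- X t \<omega>) \<partial>P) - 1) \<longlonglongrightarrow> 0" using R_int by simp
  then have exp1: "(\<integral>\<omega>. exp (- X t \<omega>) \<partial>P) = 1" by (simp add: LIMSEQ_const_iff)
  have "(\<integral>\<omega>. exp (- X 0 \<omega>) * (X t \<omega> - X 0 \<omega>) \<partial>P) = (\<integral>\<omega>. X t \<omega> \<partial>P)"
    using X0 X_meas(2)[of 0] X_meas(2)[OF t] t0 by (intro integral_cong_AE) auto
  then have mean0: "(\<integral>\<omega>. X t \<omega> \<partial>P) = 0" using orth[of 0 t] t0 by simp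
  have gap_int: "integrable P (\<lambda>\<omega>. exp (- X t \<omega>) - 1 + X t \<omega>)"
    using U_int[OF t] X_int[OF t] by auto
  moreover have "(\<integral>\<omega>. exp (- X t \<omega>) - 1 + X t \<omega> \<partial>P) = 0"
    using U_int[OF t] X_int[OF t] exp1 mean0 by (simp add: prob_space)
  moreover have "AE \<omega> in P. 0 \<le> exp (- X t \<omega>) - 1 + X t \<omega>"
    using exp_tangent_gap(1)[of _ 0] by auto
  ultimately have "AE \<omega> in P. exp (- X t \<omega>) - 1 + X t \<omega> = 0"
    using integral_nonneg_eq_0_iff_AE by blast
  then show ?thesis
  proof eventually_elim
    case (elim \<omega>)
    from exp_tangent_gap_zero[OF this] show ?case by (simp add: X_def)
  qed
qed

lemma continuous_on_eq_if_rational_eq: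
  fixes f g :: "real \<Rightarrow> real"
  assumes T: "0 < T" and f: "continuous_on {0..T} f" and g: "continuous_on {0..T} g"
    and eq: "\<And>t. t \<in> \<rat> \<inter> {0..T} \<Longrightarrow> f t = g t" and t: "t \<in> {0..T}"
  shows "f t = g t"
proof -
  have "closure (\<rat> \<inter> {0<..<T}) = {0..T}"
  proof -
    have "{0<..<T} \<subseteq> closure (\<rat> \<inter> {0<..<T})"
      using open_Int_closure_subset[of "{0<..<T}" "\<rat> :: real set"] Rats_closure_real
      by (auto simp: Int_commute)
    then have "closure {0<..<T} \<subseteq> closure (\<rat> \<inter> {0<..<T})"
      using closure_mono closure_closure by metis
    moreover have "closure (\<rat> \<inter> {0<..<T}) \<subseteq> closure {0<..<T}" by (intro closure_mono) auto
    ultimately show ?thesis using T by simp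
  qed
  then show ?thesis
    using continuous_constant_on_closure[of "\<rat> \<inter> {0<..<T}" "\<lambda>s. f s - g s" 0 t]
      continuous_on_diff[OF f g] eq t by auto
qed

text \<open>Path continuity makes the exceptional null set independent of \<open>t\<close>.\<close>

lemma deterministic_bracket_unique_path:
  assumes P: "prob_space P" and T: "0 < T" and M: "has_deterministic_bracket P F T M q"
    and q: "q 0 = 0" "mono_on {0..T} q" "continuous_on {0..T} q"
    and A: "is_quadratic_variation P F T M A"
  shows "AE \<omega> in P. \<forall>t\<in>{0..T}. A t \<omega> = q t"
proof -
  have "countable (\<rat> \<inter> {0..T})" by (simp add: countable_rat countable_Int1)
  then have "AE \<omega> in P. \<forall>t\<in>\<rat> \<inter> {0..T}. A t \<omega> = q t"
    by (subst AE_ball_countable) (auto intro: deterministic_bracket_unique[OF P M q A])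
  moreover have "AE \<omega> in P. continuous_on {0..T} (\<lambda>t. A t \<omega>)"
    using A by (auto simp: is_quadratic_variation_def)
  ultimately show ?thesis
    by eventually_elim (use continuous_on_eq_if_rational_eq[OF T _ q(3)] in blast)
qed

section \<open>Copies in law\<close>

lemma path_measurable:
  assumes "\<And>s. s \<in> {0..t} \<Longrightarrow> M s \<in> borel_measurable P"
  shows "path t M \<in> measurable P (path_space t)"
  unfolding path_def path_space_def by (rule measurable_restrict) (rule assms)

lemma path_measurableD:
  assumes "path t M \<in> measurable P (path_space t)" "s \<in> {0..t}"
  shows "M s \<in> borel_measurable P"
proof -
  have "(\<lambda>\<omega>. path t M \<omega> s) \<in> borel_measurable P"
    using assms(1) unfolding path_space_def
    by (rule measurable_compose) (rule measurable_component_singleton[OF assms(2)])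
  then show ?thesis using assms(2) by (simp add: path_def)
qed

lemma path_in_space: "path t M \<in> S \<rightarrow> space (path_space t)"
  by (auto simp: path_def path_space_def space_PiM)

lemma path_natural_filtration: "path t M \<in> measurable (natural_filtration P M t) (path_space t)"
  unfolding natural_filtration_def by (rule measurable_vimage_algebra1[OF path_in_space])

lemma sets_natural_filtration:
  "sets (natural_filtration P M t) = {path t M -` C \<inter> space P | C. C \<in> sets (path_space t)}"
  unfolding natural_filtration_def by (rule sets_vimage_algebra2[OF path_in_space])

lemma space_natural_filtration [simp]: "space (natural_filtration P M t) = space P"
  by (simp add: natural_filtration_def)

lemma natural_filtration_is_filtration:
  assumes M: "\<And>s. s \<in> {0..T} \<Longrightarrow> M s \<in> borel_measurable P"
  shows "is_filtration P T (natural_filtration P M)"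
proof -
  have le: "sets (natural_filtration P M s) \<subseteq> sets G"
    if "space G = space P" "path s M \<in> measurable G (path_space s)" for s G
  proof
    fix B assume "B \<in> sets (natural_filtration P M s)"
    then obtain C where "C \<in> sets (path_space s)" "B = path s M -` C \<inter> space P"
      by (auto simp: sets_natural_filtration)
    then show "B \<in> sets G" using measurable_sets[OF that(2)] that(1) by simp
  qed
  have "path s M \<in> measurable P (path_space s)" if "s \<in> {0..T}" for s
    using that by (intro path_measurable M) auto
  moreover have "path s M \<in> measurable (natural_filtration P M t) (path_space s)" if "s \<le> t" for s t
    using that by (intro path_measurable path_measurableD[OF path_natural_filtration]) auto
  ultimately show ?thesis
    using le by (auto simp: is_filtration_def subalgebra_def)
qed

text \<open>The law on the path space determines the martingale property in the natural filtration:
  an event of the past of \<open>M'\<close> is \<open>path s M' \<in> C\<close>, so the expectation of \<open>g t (M' t)\<close> over it is an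
  integral with respect to the common law and equals the expectation of \<open>g t (M t)\<close> over
  \<open>path s M \<in> C\<close>, an event of \<open>F s\<close>. The function \<open>g\<close> allows for both \<open>M\<close> and \<open>M\<^sup>2 - q\<close>.\<close>

lemma martingale_same_law:
  fixes M :: "real \<Rightarrow> 'a \<Rightarrow> real" and M' :: "real \<Rightarrow> 'b \<Rightarrow> real" and g :: "real \<Rightarrow> real \<Rightarrow> real"
  assumes P: "prob_space P" and Q: "prob_space Q"
    and filt: "is_filtration P T F" and adapted: "\<And>t. t \<in> {0..T} \<Longrightarrow> M t \<in> borel_measurable (F t)"
    and mart: "is_martingale P F T (\<lambda>t \<omega>. g t (M t \<omega>))"
    and g: "\<And>t. g t \<in> borel_measurable borel"
    and M': "path T M' \<in> measurable Q (path_space T)"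
    and law: "distr Q (path_space T) (path T M') = distr P (path_space T) (path T M)"
  shows "is_martingale Q (natural_filtration Q M') T (\<lambda>t \<omega>. g t (M' t \<omega>))"
proof -
  interpret P: prob_space P by (rule P)
  interpret Q: prob_space Q by (rule Q)
  have MP: "M t \<in> borel_measurable P" if "t \<in> {0..T}" for t
    using filtration_measurable[OF filt that adapted[OF that]] .
  have M_path: "path T M \<in> measurable P (path_space T)"
    by (rule path_measurable) (rule MP)
  have M'Q: "M' t \<in> borel_measurable Q" if "t \<in> {0..T}" for t
    using path_measurableD[OF M' that] .
  have filt': "is_filtration Q T (natural_filtration Q M')"
    by (rule natural_filtration_is_filtration) (rule M'Q)
  have adapted': "M' t \<in> borel_measurable (natural_filtration Q M' t)" if "t \<in> {0..T}" for t
    using that by (intro path_measurableD[OF path_natural_filtration]) auto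
  have coord: "(\<lambda>w. w t) \<in> borel_measurable (path_space T)" if "t \<in> {0..T}" for t
    unfolding path_space_def by (rule measurable_component_singleton[OF that])
  have at: "path T X \<omega> t = X t \<omega>" if "t \<in> {0..T}" for X :: "real \<Rightarrow> 'c \<Rightarrow> real" and \<omega> t
    using that by (simp add: path_def)
  have int: "integrable Q (\<lambda>\<omega>. g t (M' t \<omega>))" if t: "t \<in> {0..T}" for t
  proof -
    have h: "(\<lambda>w. g t (w t)) \<in> borel_measurable (path_space T)"
      using coord[OF t] g by (rule measurable_compose)
    have "integrable P (\<lambda>\<omega>. g t (path T M \<omega> t))"
      using mart t by (simp add: is_martingale_def at)
    then have "integrable (distr Q (path_space T) (path T M')) (\<lambda>w. g t (w t))"
      unfolding law by (subst integrable_distr_eq[OF M_path h])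
    then show ?thesis
      by (subst (asm) integrable_distr_eq[OF M' h]) (simp add: at[OF t])
  qed
  have transfer: "(LINT \<omega>:path s M' -` C \<inter> space Q|Q. g t (M' t \<omega>))
      = (LINT \<omega>:path s M -` C \<inter> space P|P. g t (M t \<omega>))"
    if C: "C \<in> sets (path_space s)" and s: "s \<in> {0..T}" and t: "t \<in> {0..T}" for C s t
  proof -
    let ?\<Phi> = "\<lambda>w. indicator C (restrict w {0..s}) * g t (w t)"
    have restr: "(\<lambda>w. restrict w {0..s}) \<in> measurable (path_space T) (path_space s)"
      using s unfolding path_space_def by (intro measurable_restrict_subset) auto
    have "(\<lambda>w. indicator C (restrict w {0..s}) :: real) \<in> borel_measurable (path_space T)"
      using restr borel_measurable_indicator[OF C] by (rule measurable_compose)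
    moreover have "(\<lambda>w. g t (w t)) \<in> borel_measurable (path_space T)"
      using coord[OF t] g by (rule measurable_compose)
    ultimately have \<Phi>: "?\<Phi> \<in> borel_measurable (path_space T)"
      by (rule borel_measurable_times)
    have eq: "(LINT \<omega>:path s X -` C \<inter> space R|R. g t (X t \<omega>)) = (\<integral>\<omega>. ?\<Phi> (path T X \<omega>) \<partial>R)"
      for R :: "'c measure" and X :: "real \<Rightarrow> 'c \<Rightarrow> real"
      unfolding set_lebesgue_integral_def
    proof (rule Bochner_Integration.integral_cong[OF refl])
      fix \<omega> assume "\<omega> \<in> space R"
      moreover have "restrict (path T X \<omega>) {0..s} = path s X \<omega>"
        using s by (auto simp: path_def restrict_def)
      ultimately show "indicator (path s X -` C \<inter> space R) \<omega> *\<^sub>R g t (X t \<omega>) = ?\<Phi> (path T X \<omega>)"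
        by (simp add: at[OF t] indicator_def)
    qed
    show ?thesis
      unfolding eq integral_distr[OF M' \<Phi>, symmetric] integral_distr[OF M_path \<Phi>, symmetric] law ..
  qed
  have "AE \<omega> in Q. real_cond_exp Q (natural_filtration Q M' s) (\<lambda>\<omega>. g t (M' t \<omega>)) \<omega> = g s (M' s \<omega>)"
    if s: "s \<in> {0..T}" and t: "t \<in> {s..T}" for s t
  proof -
    have t': "t \<in> {0..T}" and st: "0 \<le> s" "s \<le> t" "t \<le> T" using s t by auto
    have sub: "subalgebra Q (natural_filtration Q M' s)"
      using filt' s by (simp add: is_filtration_def)
    interpret finite_measure_subalgebra Q "natural_filtration Q M' s" by unfold_locales (rule sub)
    show ?thesis
    proof (rule real_cond_exp_charact)
      fix B assume "B \<in> sets (natural_filtration Q M' s)"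
      then obtain C where C: "C \<in> sets (path_space s)" and B: "B = path s M' -` C \<inter> space Q"
        by (auto simp: sets_natural_filtration)
      define D where "D = path s M -` C \<inter> space P"
      have path_s: "path s M \<in> measurable (F s) (path_space s)"
      proof (rule path_measurable)
        fix r assume "r \<in> {0..s}"
        then show "M r \<in> borel_measurable (F s)"
          using s filtration_measurable_mono[OF filt _ _ _ adapted, of r s] by auto
      qed
      have "space (F s) = space P" using filt s by (simp add: is_filtration_def subalgebra_def)
      then have D: "D \<in> sets (F s)"
        unfolding D_def using measurable_sets[OF path_s C] by simp
      have intP: "integrable P (\<lambda>\<omega>. indicator D \<omega> * g t (M t \<omega>))"
      proof -
        have "D \<in> sets P" using D filt s by (auto simp: is_filtration_def subalgebra_def)
        moreover have "integrable P (\<lambda>\<omega>. g t (M t \<omega>))" using mart t' by (simp add: is_martingale_def)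
        ultimately have "integrable P (\<lambda>\<omega>. indicator D \<omega> *\<^sub>R g t (M t \<omega>))"
          by (rule integrable_mult_indicator)
        then show ?thesis by simp
      qed
      have "(LINT \<omega>:D|P. g t (M t \<omega>)) = (LINT \<omega>:D|P. g s (M s \<omega>))"
        unfolding set_lebesgue_integral_def real_scaleR_def
        by (rule martingale_increment_orthogonal[OF P mart st _ intP]) (rule borel_measurable_indicator[OF D])
      then show "(LINT \<omega>:B|Q. g t (M' t \<omega>)) = (LINT \<omega>:B|Q. g s (M' s \<omega>))"
        unfolding B transfer[OF C s t'] transfer[OF C s s] D_def .
    qed (use int t' s measurable_compose[OF adapted'[OF s] g] in auto)
  qed
  moreover have "(\<lambda>\<omega>. g t (M' t \<omega>)) \<in> borel_measurable (natural_filtration Q M' t)"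
    if "t \<in> {0..T}" for t
    using adapted'[OF that] g by (rule measurable_compose)
  ultimately show ?thesis
    unfolding is_martingale_def by (intro conjI ballI filt' int)
qed

text \<open>Independence of the paths passes to all variables that are measurable with respect to the
  \<open>\<sigma>\<close>-algebras they generate, in particular to simple stochastic integrals.\<close>

lemma independent_product_expectation:
  fixes U V :: "'b \<Rightarrow> real"
  assumes Q: "prob_space Q"
    and ind: "prob_space.indep_vars Q (\<lambda>_. path_space T) (\<lambda>i. path T (Ms i)) K"
    and ij: "i \<in> K" "j \<in> K" "i \<noteq> j"
    and U: "U \<in> borel_measurable (natural_filtration Q (Ms i) T)" "integrable Q U"
    and V: "V \<in> borel_measurable (natural_filtration Q (Ms j) T)" "integrable Q V"
  shows "(\<integral>\<omega>. U \<omega> * V \<omega> \<partial>Q) = (\<integral>\<omega>. U \<omega> \<partial>Q) * (\<integral>\<omega>. V \<omega> \<partial>Q)"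
proof -
  interpret prob_space Q by (rule Q)
  have sub: "{X -` A \<inter> space Q |A. A \<in> sets borel} \<subseteq> sets (natural_filtration Q (Ms k) T)"
    if "X \<in> borel_measurable (natural_filtration Q (Ms k) T)" for X :: "'b \<Rightarrow> real" and k
    using that measurable_sets[OF that] by auto
  have sets: "indep_sets (\<lambda>i. sets (natural_filtration Q (Ms i) T)) K"
    using ind by (simp add: indep_vars_def2 sets_natural_filtration)
  have ind_F: "indep_set (sets (natural_filtration Q (Ms i) T)) (sets (natural_filtration Q (Ms j) T))"
    unfolding indep_sets2_eq
  proof (intro conjI ballI)
    show "sets (natural_filtration Q (Ms i) T) \<subseteq> events" "sets (natural_filtration Q (Ms j) T) \<subseteq> events"
      using sets ij by (auto simp: indep_sets_def)
    fix a b
    assume "a \<in> sets (natural_filtration Q (Ms i) T)" "b \<in> sets (natural_filtration Q (Ms j) T)"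
    then show "prob (a \<inter> b) = prob a * prob b"
      using indep_setsD[OF sets, of "{i, j}" "\<lambda>k. if k = i then a else b"] ij
      by (auto simp: Int_commute)
  qed
  have ind_UV: "indep_set {U -` A \<inter> space Q |A. A \<in> sets borel} {V -` A \<inter> space Q |A. A \<in> sets borel}"
    using ind_F unfolding indep_set_def
    by (rule indep_sets_mono_sets) (use sub[OF U(1)] sub[OF V(1)] in \<open>simp split: bool.split\<close>)
  have stable: "Int_stable {X -` A \<inter> space Q |A. A \<in> sets borel}" for X :: "'b \<Rightarrow> real"
  proof (intro Int_stableI)
    fix a b assume "a \<in> {X -` A \<inter> space Q |A. A \<in> sets borel}" "b \<in> {X -` A \<inter> space Q |A. A \<in> sets borel}"
    then obtain A B where "A \<in> sets borel" "B \<in> sets borel" "a = X -` A \<inter> space Q" "b = X -` B \<inter> space Q"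
      by auto
    then show "a \<inter> b \<in> {X -` A \<inter> space Q |A. A \<in> sets borel}"
      by (intro CollectI exI[of _ "A \<inter> B"]) auto
  qed
  have "indep_var borel U borel V"
    unfolding indep_var_eq
    using U(2) V(2) by (intro conjI indep_set_sigma_sets ind_UV stable) auto
  then show ?thesis by (rule indep_var_lebesgue_integral[OF _ U(2) V(2)])
qed

section \<open>Second moments of Ito integrals\<close>

text \<open>The triangle inequality in \<open>L\<^sup>2\<close>, in a form that only speaks of squares and
  also makes sense when some of the integrals are infinite; letting \<open>\<epsilon>\<close> tend to \<open>0\<close> after the error
  term has vanished recovers the sharp constant.\<close>

lemma nn_integral_square_split:
  fixes f g :: "'c \<Rightarrow> real" and \<epsilon> :: real
  assumes [measurable]: "f \<in> borel_measurable N" "g \<in> borel_measurable N" and \<epsilon>: "\<epsilon> > 0"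
  shows "(\<integral>\<^sup>+x. ennreal ((f x)\<^sup>2) \<partial>N)
    \<le> ennreal (1 + \<epsilon>) * (\<integral>\<^sup>+x. ennreal ((g x)\<^sup>2) \<partial>N)
      + ennreal (1 + 1 / \<epsilon>) * (\<integral>\<^sup>+x. ennreal ((g x - f x)\<^sup>2) \<partial>N)"
proof -
  have pt: "a\<^sup>2 \<le> (1 + \<epsilon>) * b\<^sup>2 + (1 + 1 / \<epsilon>) * (b - a)\<^sup>2" for a b :: real
  proof -
    have "0 \<le> (\<epsilon> * b + (b - a))\<^sup>2 / \<epsilon>" using \<epsilon> by simp
    also have "\<dots> = (1 + \<epsilon>) * b\<^sup>2 + (1 + 1 / \<epsilon>) * (b - a)\<^sup>2 - a\<^sup>2"
      using \<epsilon> by (simp add: field_simps power2_eq_square)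
    finally show ?thesis by simp
  qed
  have "(\<integral>\<^sup>+x. ennreal ((f x)\<^sup>2) \<partial>N)
    \<le> (\<integral>\<^sup>+x. ennreal (1 + \<epsilon>) * ennreal ((g x)\<^sup>2) + ennreal (1 + 1 / \<epsilon>) * ennreal ((g x - f x)\<^sup>2) \<partial>N)"
    using pt \<epsilon> by (intro nn_integral_mono)
      (simp flip: ennreal_mult ennreal_plus add: ennreal_leI)
  also have "\<dots> = ennreal (1 + \<epsilon>) * (\<integral>\<^sup>+x. ennreal ((g x)\<^sup>2) \<partial>N)
      + ennreal (1 + 1 / \<epsilon>) * (\<integral>\<^sup>+x. ennreal ((g x - f x)\<^sup>2) \<partial>N)"
    by (subst nn_integral_add) (auto simp: nn_integral_cmult)
  finally show ?thesis .
qed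

text \<open>The intervals are disjoint, so no mixed terms appear.\<close>

lemma simple_process_square:
  assumes "is_simple_predictable P F T n t \<xi>"
  shows "(simple_process n t \<xi> s \<omega>)\<^sup>2 = (\<Sum>k<n. (\<xi> k \<omega>)\<^sup>2 * indicator {t k<..t (Suc k)} s)"
  using assms
proof (induction n)
  case 0
  then show ?case by (simp add: simple_process_def)
next
  case (Suc n)
  have "simple_process n t \<xi> s \<omega> * indicator {t n<..t (Suc n)} s = 0"
  proof (cases "t n < s")
    case True
    have "indicator {t k<..t (Suc k)} s = (0 :: real)" if "k < n" for k
      using simple_predictable_mono[OF Suc.prems, of "Suc k" n] that True by (simp add: indicator_def)
    then show ?thesis by (simp add: simple_process_def)
  qed simp
  moreover have "simple_process (Suc n) t \<xi> s \<omega>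
      = simple_process n t \<xi> s \<omega> + \<xi> n \<omega> * indicator {t n<..t (Suc n)} s"
    by (simp add: simple_process_def)
  ultimately have "(simple_process (Suc n) t \<xi> s \<omega>)\<^sup>2
      = (simple_process n t \<xi> s \<omega>)\<^sup>2 + (\<xi> n \<omega>)\<^sup>2 * indicator {t n<..t (Suc n)} s"
    by (auto simp: power2_sum indicator_def)
  then show ?case
    using Suc.IH[OF simple_predictable_pred[OF Suc.prems]] by simp
qed

lemma simple_process_energy:
  assumes T: "0 < T" and mono: "mono_on {0..T} q" and cont: "continuous_on {0..T} q"
    and simple: "is_simple_predictable P F T n t \<xi>"
  shows "(\<integral>\<^sup>+s\<in>{0..T}. ennreal ((simple_process n t \<xi> s \<omega>)\<^sup>2) \<partial>stieltjes T q)
    = ennreal (\<Sum>k<n. (q (t (Suc k)) - q (t k)) * (\<xi> k \<omega>)\<^sup>2)"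
proof -
  have t: "0 \<le> t k" "t k \<le> t (Suc k)" "t (Suc k) \<le> T" if "k < n" for k
    using simple_predictable_times[OF simple, of k] simple_predictable_times[OF simple, of "Suc k"]
      simple_predictable_mono[OF simple, of k "Suc k"] that by auto
  have inc: "0 \<le> q (t (Suc k)) - q (t k)" if "k < n" for k
    using mono_onD[OF mono, of "t k" "t (Suc k)"] t[OF that] by auto
  have mass: "emeasure (stieltjes T q) {t k<..t (Suc k)} = ennreal (q (t (Suc k)) - q (t k))"
    if "k < n" for k
    using emeasure_stieltjes_Ioc[OF T mono cont t(2)[OF that]] t[OF that] by simp
  have "(\<integral>\<^sup>+s\<in>{0..T}. ennreal ((simple_process n t \<xi> s \<omega>)\<^sup>2) \<partial>stieltjes T q)
    = (\<integral>\<^sup>+s. (\<Sum>k<n. ennreal ((\<xi> k \<omega>)\<^sup>2) * indicator {t k<..t (Suc k)} s) \<partial>stieltjes T q)"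
  proof (rule nn_integral_cong)
    fix s
    have "ennreal ((simple_process n t \<xi> s \<omega>)\<^sup>2)
        = (\<Sum>k<n. ennreal ((\<xi> k \<omega>)\<^sup>2) * indicator {t k<..t (Suc k)} s)"
      unfolding simple_process_square[OF simple]
      by (subst sum_ennreal[symmetric]) (auto simp: indicator_def intro!: sum.cong)
    moreover have "(\<Sum>k<n. ennreal ((\<xi> k \<omega>)\<^sup>2) * indicator {t k<..t (Suc k)} s) * indicator {0..T} s
        = (\<Sum>k<n. ennreal ((\<xi> k \<omega>)\<^sup>2) * indicator {t k<..t (Suc k)} s)"
      unfolding sum_distrib_right
    proof (rule sum.cong[OF refl])
      fix k assume "k \<in> {..<n}"
      then show "ennreal ((\<xi> k \<omega>)\<^sup>2) * indicator {t k<..t (Suc k)} s * indicator {0..T} s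
          = ennreal ((\<xi> k \<omega>)\<^sup>2) * indicator {t k<..t (Suc k)} s"
        using t[of k] by (auto simp: indicator_def)
    qed
    ultimately show "ennreal ((simple_process n t \<xi> s \<omega>)\<^sup>2) * indicator {0..T} s
        = (\<Sum>k<n. ennreal ((\<xi> k \<omega>)\<^sup>2) * indicator {t k<..t (Suc k)} s)" by simp
  qed
  also have "\<dots> = (\<Sum>k<n. ennreal ((\<xi> k \<omega>)\<^sup>2) * ennreal (q (t (Suc k)) - q (t k)))"
    by (subst nn_integral_sum) (auto simp: nn_integral_cmult_indicator mass)
  also have "\<dots> = (\<Sum>k<n. ennreal ((q (t (Suc k)) - q (t k)) * (\<xi> k \<omega>)\<^sup>2))"
    using inc by (intro sum.cong) (auto simp: ennreal_mult mult.commute)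
  also have "\<dots> = ennreal (\<Sum>k<n. (q (t (Suc k)) - q (t k)) * (\<xi> k \<omega>)\<^sup>2)"
    using inc by (intro sum_ennreal) auto
  finally show ?thesis .
qed

lemma simple_integral_energy:
  assumes P: "prob_space P" and M: "has_deterministic_bracket P F T M q"
    and T: "0 < T" and mono: "mono_on {0..T} q" and cont: "continuous_on {0..T} q"
    and simple: "is_simple_predictable P F T n t \<xi>"
  shows "(\<integral>\<^sup>+\<omega>. ennreal ((simple_integral n t \<xi> M \<omega>)\<^sup>2) \<partial>P)
    = (\<integral>\<^sup>+\<omega>. (\<integral>\<^sup>+s\<in>{0..T}. ennreal ((simple_process n t \<xi> s \<omega>)\<^sup>2) \<partial>stieltjes T q) \<partial>P)"
proof -
  interpret prob_space P by (rule P)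
  have t: "0 \<le> t k" "t k \<le> t (Suc k)" "t (Suc k) \<le> T" if "k < n" for k
    using simple_predictable_times[OF simple, of k] simple_predictable_times[OF simple, of "Suc k"]
      simple_predictable_mono[OF simple, of k "Suc k"] that by auto
  have inc: "0 \<le> q (t (Suc k)) - q (t k)" if "k < n" for k
    using mono_onD[OF mono, of "t k" "t (Suc k)"] t[OF that] by auto
  have filt: "is_filtration P T F"
    using M by (auto simp: has_deterministic_bracket_def is_martingale_def)
  have \<xi>_int: "integrable P (\<lambda>\<omega>. (\<xi> k \<omega>)\<^sup>2)" if k: "k < n" for k
  proof -
    obtain C where C: "\<And>\<omega>. \<omega> \<in> space P \<Longrightarrow> \<bar>\<xi> k \<omega>\<bar> \<le> C" and \<xi>: "\<xi> k \<in> borel_measurable (F (t k))"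
      using simple k unfolding is_simple_predictable_def by blast
    have "t k \<in> {0..T}" using t[OF k] by auto
    then have [measurable]: "\<xi> k \<in> borel_measurable P"
      using filtration_measurable[OF filt _ \<xi>] by blast
    show ?thesis
      using power_mono[OF C abs_ge_zero, of _ 2]
      by (intro integrable_const_bound[where B = "C\<^sup>2"] AE_I2) auto
  qed
  note iso = simple_integral_isometry[OF P M simple]
  have sum_int: "integrable P (\<lambda>\<omega>. \<Sum>k<n. (q (t (Suc k)) - q (t k)) * (\<xi> k \<omega>)\<^sup>2)"
    using \<xi>_int by (intro Bochner_Integration.integrable_sum integrable_mult_right) auto
  have "(\<integral>\<^sup>+\<omega>. ennreal ((simple_integral n t \<xi> M \<omega>)\<^sup>2) \<partial>P)
      = ennreal (\<Sum>k<n. (q (t (Suc k)) - q (t k)) * (\<integral>\<omega>. (\<xi> k \<omega>)\<^sup>2 \<partial>P))"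
    using iso(2,3) by (subst nn_integral_eq_integral) auto
  also have "\<dots> = ennreal (\<integral>\<omega>. (\<Sum>k<n. (q (t (Suc k)) - q (t k)) * (\<xi> k \<omega>)\<^sup>2) \<partial>P)"
    using \<xi>_int by (subst Bochner_Integration.integral_sum) auto
  also have "\<dots> = (\<integral>\<^sup>+\<omega>. ennreal (\<Sum>k<n. (q (t (Suc k)) - q (t k)) * (\<xi> k \<omega>)\<^sup>2) \<partial>P)"
    using inc by (intro nn_integral_eq_integral[symmetric] sum_int AE_I2 sum_nonneg) auto
  finally show ?thesis by (simp add: simple_process_energy[OF T mono cont simple])
qed

lemma nn_sqnorm:
  assumes "in_L2 T q h"
  shows "(\<integral>\<^sup>+s\<in>{0..T}. ennreal ((h s)\<^sup>2) \<partial>stieltjes T q) = ennreal (sqnorm T q h)"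
proof -
  have "(\<integral>\<^sup>+s\<in>{0..T}. ennreal ((h s)\<^sup>2) \<partial>stieltjes T q)
      = (\<integral>\<^sup>+s. ennreal (indicator {0..T} s * (h s)\<^sup>2) \<partial>stieltjes T q)"
    by (intro nn_integral_cong) (auto simp: indicator_def)
  also have "\<dots> = ennreal (\<integral>s. indicator {0..T} s * (h s)\<^sup>2 \<partial>stieltjes T q)"
    using assms by (intro nn_integral_eq_integral) (auto simp: in_L2_def set_integrable_def)
  finally show ?thesis by (simp add: sqnorm_def set_lebesgue_integral_def)
qed

text \<open>What is retained of the definition of the Ito integral of a deterministic \<open>h\<close>: centred,
  square integrable approximations \<open>S l\<close>, known at time \<open>T\<close>, whose second
  moments are asymptotically at most \<open>\<parallel>h\<parallel>\<^sup>2\<close>. By the simple isometry the second moment of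
  \<open>S l\<close> is the \<open>L\<^sup>2(P \<otimes> dq)\<close> norm of its integrand, which tends to \<open>h\<close>. The error
  \<open>\<delta> l\<close> does not depend on \<open>\<epsilon>\<close>, so that \<open>l\<close> can go to infinity first.\<close>

lemma ito_integral_approximation:
  assumes P: "prob_space P" and M: "has_deterministic_bracket P F T M q"
    and T: "0 < T" and mono: "mono_on {0..T} q" and cont: "continuous_on {0..T} q"
    and A: "AE \<omega> in P. \<forall>t\<in>{0..T}. A t \<omega> = q t" and h: "in_L2 T q h"
    and X: "has_ito_integral P F T M A (\<lambda>s _. h s) X"
  obtains S \<delta> where
    "\<And>l. S l \<in> borel_measurable (F T)"
    "\<And>l. integrable P (\<lambda>\<omega>. (S l \<omega>)\<^sup>2)"
    "\<And>l. (\<integral>\<omega>. S l \<omega> \<partial>P) = 0"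
    "(\<lambda>l. \<integral>\<^sup>+\<omega>. ennreal ((S l \<omega> - X \<omega>)\<^sup>2) \<partial>P) \<longlonglongrightarrow> 0"
    "(\<delta> :: nat \<Rightarrow> ennreal) \<longlonglongrightarrow> 0"
    "\<And>\<epsilon> l. \<epsilon> > 0 \<Longrightarrow> (\<integral>\<^sup>+\<omega>. ennreal ((S l \<omega>)\<^sup>2) \<partial>P)
        \<le> ennreal (1 + \<epsilon>) * ennreal (sqnorm T q h) + ennreal (1 + 1 / \<epsilon>) * \<delta> l"
proof -
  interpret prob_space P by (rule P)
  interpret st: sigma_finite_measure "stieltjes T q" by (rule sigma_finite_stieltjes[OF T mono cont])
  have filt: "is_filtration P T F"
    using M by (auto simp: has_deterministic_bracket_def is_martingale_def)
  obtain n t \<xi> where simple: "\<And>l. is_simple_predictable P F T (n l) (t l) (\<xi> l)"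
    and \<delta>A: "(\<lambda>l::nat. \<integral>\<^sup>+\<omega>. (\<integral>\<^sup>+s\<in>{0..T}. ennreal ((simple_process (n l) (t l) (\<xi> l) s \<omega> - h s)\<^sup>2)
                     \<partial>stieltjes T (\<lambda>r. A r \<omega>)) \<partial>P) \<longlonglongrightarrow> 0"
    and S: "(\<lambda>l. \<integral>\<^sup>+\<omega>. ennreal ((simple_integral (n l) (t l) (\<xi> l) M \<omega> - X \<omega>)\<^sup>2) \<partial>P) \<longlonglongrightarrow> 0"
    using X unfolding has_ito_integral_def by blast
  let ?H = "\<lambda>l. simple_process (n l) (t l) (\<xi> l)" and ?S = "\<lambda>l. simple_integral (n l) (t l) (\<xi> l) M"
  define \<delta> where "\<delta> l = (\<integral>\<^sup>+\<omega>. (\<integral>\<^sup>+s\<in>{0..T}. ennreal ((?H l s \<omega> - h s)\<^sup>2) \<partial>stieltjes T q) \<partial>P)" for l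
  \<comment> \<open>The approximation is measured by \<open>dA\<close>, which is \<open>dq\<close> for almost every \<open>\<omega>\<close>.\<close>
  have \<delta>_A: "(\<integral>\<^sup>+\<omega>. (\<integral>\<^sup>+s\<in>{0..T}. ennreal ((?H l s \<omega> - h s)\<^sup>2) \<partial>stieltjes T (\<lambda>r. A r \<omega>)) \<partial>P) = \<delta> l" for l
    unfolding \<delta>_def
  proof (rule nn_integral_cong_AE)
    show "AE \<omega> in P. (\<integral>\<^sup>+s\<in>{0..T}. ennreal ((?H l s \<omega> - h s)\<^sup>2) \<partial>stieltjes T (\<lambda>r. A r \<omega>))
        = (\<integral>\<^sup>+s\<in>{0..T}. ennreal ((?H l s \<omega> - h s)\<^sup>2) \<partial>stieltjes T q)"
      using A
    proof eventually_elim
      case (elim \<omega>)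
      then have "stieltjes T (\<lambda>r. A r \<omega>) = stieltjes T q" by (intro stieltjes_cong[OF T]) auto
      then show ?case by simp
    qed
  qed
  have \<delta>0: "\<delta> \<longlonglongrightarrow> 0" using \<delta>A unfolding \<delta>_A .
  have iso: "?S l \<in> borel_measurable (F (t l (n l)))" "integrable P (\<lambda>\<omega>. (?S l \<omega>)\<^sup>2)"
    "(\<integral>\<omega>. ?S l \<omega> \<partial>P) = 0" for l
    using simple_integral_isometry[OF P M simple] by auto
  have tn: "0 \<le> t l (n l)" "t l (n l) \<le> T" for l
    using simple_predictable_times[OF simple, of "n l" l] by auto
  have S_meas: "?S l \<in> borel_measurable (F T)" for l
    using filtration_measurable_mono[OF filt tn(1) tn(2) order_refl iso(1)] .
  have bound: "(\<integral>\<^sup>+\<omega>. ennreal ((?S l \<omega>)\<^sup>2) \<partial>P)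
        \<le> ennreal (1 + \<epsilon>) * ennreal (sqnorm T q h) + ennreal (1 + 1 / \<epsilon>) * \<delta> l" if \<epsilon>: "\<epsilon> > 0" for \<epsilon> l
  proof -
    have [measurable]: "\<xi> l k \<in> borel_measurable P" if "k < n l" for k
    proof -
      have "\<xi> l k \<in> borel_measurable (F (t l k))"
        using simple[of l] that by (auto simp: is_simple_predictable_def)
      moreover have "t l k \<in> {0..T}" using simple_predictable_times[OF simple, of k l] that by auto
      ultimately show ?thesis using filtration_measurable[OF filt] by blast
    qed
    have h_meas[measurable]: "(\<lambda>s. indicator {0..T} s * h s) \<in> borel_measurable borel"
      by (rule in_L2_measurable[OF h])
    let ?f = "\<lambda>s \<omega>. indicator {0..T} s * ?H l s \<omega>" and ?g = "\<lambda>s. indicator {0..T} s * h s"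
    have joint: "(\<lambda>(\<omega>, s). ?f s \<omega>) \<in> borel_measurable (P \<Otimes>\<^sub>M stieltjes T q)"
      unfolding simple_process_def split_beta' by measurable
    have [measurable]: "(\<lambda>s. ?f s \<omega>) \<in> borel_measurable borel" for \<omega>
      unfolding simple_process_def by measurable
    have diff: "(\<lambda>(\<omega>, s). ennreal ((?g s - ?f s \<omega>)\<^sup>2)) \<in> borel_measurable (P \<Otimes>\<^sub>M stieltjes T q)"
    proof -
      have "(\<lambda>p. ?g (snd p)) \<in> borel_measurable (P \<Otimes>\<^sub>M stieltjes T q)"
        using measurable_compose[OF measurable_snd, of ?g "stieltjes T q" borel P] h_meas
        by (simp cong: measurable_cong_sets)
      then show ?thesis using joint by (simp add: split_beta')
    qed
    have inner: "(\<integral>\<^sup>+s\<in>{0..T}. ennreal ((?H l s \<omega>)\<^sup>2) \<partial>stieltjes T q)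
        \<le> ennreal (1 + \<epsilon>) * ennreal (sqnorm T q h)
          + ennreal (1 + 1 / \<epsilon>) * (\<integral>\<^sup>+s. ennreal ((?g s - ?f s \<omega>)\<^sup>2) \<partial>stieltjes T q)" for \<omega>
    proof -
      have "(\<integral>\<^sup>+s\<in>{0..T}. ennreal ((?H l s \<omega>)\<^sup>2) \<partial>stieltjes T q)
          = (\<integral>\<^sup>+s. ennreal ((?f s \<omega>)\<^sup>2) \<partial>stieltjes T q)"
        by (intro nn_integral_cong) (auto simp: indicator_def)
      also have "\<dots> \<le> ennreal (1 + \<epsilon>) * (\<integral>\<^sup>+s. ennreal ((?g s)\<^sup>2) \<partial>stieltjes T q)
          + ennreal (1 + 1 / \<epsilon>) * (\<integral>\<^sup>+s. ennreal ((?g s - ?f s \<omega>)\<^sup>2) \<partial>stieltjes T q)"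
        by (rule nn_integral_square_split[OF _ _ \<epsilon>]) simp_all
      also have "(\<integral>\<^sup>+s. ennreal ((?g s)\<^sup>2) \<partial>stieltjes T q)
          = (\<integral>\<^sup>+s\<in>{0..T}. ennreal ((h s)\<^sup>2) \<partial>stieltjes T q)"
        by (intro nn_integral_cong) (auto simp: indicator_def)
      finally show ?thesis by (simp add: nn_sqnorm[OF h])
    qed
    have \<delta>_eq: "\<delta> l = (\<integral>\<^sup>+\<omega>. (\<integral>\<^sup>+s. ennreal ((?g s - ?f s \<omega>)\<^sup>2) \<partial>stieltjes T q) \<partial>P)"
      unfolding \<delta>_def
      by (intro nn_integral_cong) (auto simp: indicator_def power2_commute)
    have meas: "(\<lambda>\<omega>. \<integral>\<^sup>+s. ennreal ((?g s - ?f s \<omega>)\<^sup>2) \<partial>stieltjes T q) \<in> borel_measurable P"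
      using st.borel_measurable_nn_integral[OF diff] by simp
    have "(\<integral>\<^sup>+\<omega>. ennreal ((?S l \<omega>)\<^sup>2) \<partial>P)
        \<le> (\<integral>\<^sup>+\<omega>. ennreal (1 + \<epsilon>) * ennreal (sqnorm T q h)
          + ennreal (1 + 1 / \<epsilon>) * (\<integral>\<^sup>+s. ennreal ((?g s - ?f s \<omega>)\<^sup>2) \<partial>stieltjes T q) \<partial>P)"
      unfolding simple_integral_energy[OF P M T mono cont simple] by (intro nn_integral_mono inner)
    also have "\<dots> = ennreal (1 + \<epsilon>) * ennreal (sqnorm T q h) + ennreal (1 + 1 / \<epsilon>) * \<delta> l"
      unfolding \<delta>_eq using meas
      by (subst nn_integral_add) (auto simp: nn_integral_cmult emeasure_space_1)
    finally show ?thesis .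
  qed
  show ?thesis
    by (rule that[of ?S \<delta>]) (use S_meas iso S \<delta>0 bound in auto)
qed

lemma centered_independent_sum_square:
  fixes S :: "nat \<Rightarrow> 'b \<Rightarrow> real"
  assumes Q: "prob_space Q"
    and ind: "prob_space.indep_vars Q (\<lambda>_. path_space T) (\<lambda>i. path T (Ms i)) K"
    and "finite K"
    and meas: "\<And>i. i \<in> K \<Longrightarrow> S i \<in> borel_measurable (natural_filtration Q (Ms i) T)"
    and measQ: "\<And>i. i \<in> K \<Longrightarrow> S i \<in> borel_measurable Q"
    and sq: "\<And>i. i \<in> K \<Longrightarrow> integrable Q (\<lambda>\<omega>. (S i \<omega>)\<^sup>2)"
    and mean: "\<And>i. i \<in> K \<Longrightarrow> (\<integral>\<omega>. S i \<omega> \<partial>Q) = 0"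
  shows "(\<integral>\<^sup>+\<omega>. ennreal ((\<Sum>i\<in>K. S i \<omega>)\<^sup>2) \<partial>Q) = (\<Sum>i\<in>K. \<integral>\<^sup>+\<omega>. ennreal ((S i \<omega>)\<^sup>2) \<partial>Q)"
proof -
  interpret prob_space Q by (rule Q)
  have prod_int: "integrable Q (\<lambda>\<omega>. S i \<omega> * S j \<omega>)" if "i \<in> K" "j \<in> K" for i j
    by (rule square_integrable_mult[OF measQ measQ sq sq]) (rule that)+
  have int: "integrable Q (S i)" if "i \<in> K" for i
    by (rule square_integrable_imp_integrable[OF measQ sq]) (rule that)+
  have prod: "(\<integral>\<omega>. S i \<omega> * S j \<omega> \<partial>Q) = (if i = j then \<integral>\<omega>. (S i \<omega>)\<^sup>2 \<partial>Q else 0)"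
    if "i \<in> K" "j \<in> K" for i j
    using independent_product_expectation[OF Q ind that _ meas[OF that(1)] int[OF that(1)]
        meas[OF that(2)] int[OF that(2)]] mean[OF that(1)]
    by (auto simp: power2_eq_square)
  have expand: "(\<Sum>i\<in>K. S i \<omega>)\<^sup>2 = (\<Sum>i\<in>K. \<Sum>j\<in>K. S i \<omega> * S j \<omega>)" for \<omega>
    by (simp add: power2_eq_square sum_product)
  have int2: "integrable Q (\<lambda>\<omega>. (\<Sum>i\<in>K. S i \<omega>)\<^sup>2)"
    unfolding expand by (intro Bochner_Integration.integrable_sum prod_int)
  have "(\<integral>\<omega>. (\<Sum>i\<in>K. S i \<omega>)\<^sup>2 \<partial>Q) = (\<Sum>i\<in>K. \<Sum>j\<in>K. \<integral>\<omega>. S i \<omega> * S j \<omega> \<partial>Q)"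
    unfolding expand using prod_int
    by (subst Bochner_Integration.integral_sum)
      (auto intro!: Bochner_Integration.integrable_sum sum.cong Bochner_Integration.integral_sum)
  also have "\<dots> = (\<Sum>i\<in>K. \<integral>\<omega>. (S i \<omega>)\<^sup>2 \<partial>Q)"
    using prod \<open>finite K\<close> by (intro sum.cong refl) (simp add: sum.delta)
  finally have real: "(\<integral>\<omega>. (\<Sum>i\<in>K. S i \<omega>)\<^sup>2 \<partial>Q) = (\<Sum>i\<in>K. \<integral>\<omega>. (S i \<omega>)\<^sup>2 \<partial>Q)" .
  have "(\<integral>\<^sup>+\<omega>. ennreal ((\<Sum>i\<in>K. S i \<omega>)\<^sup>2) \<partial>Q) = ennreal (\<Sum>i\<in>K. \<integral>\<omega>. (S i \<omega>)\<^sup>2 \<partial>Q)"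
    unfolding real[symmetric] by (rule nn_integral_eq_integral[OF int2]) simp
  also have "\<dots> = (\<Sum>i\<in>K. ennreal (\<integral>\<omega>. (S i \<omega>)\<^sup>2 \<partial>Q))"
    by (intro sum_ennreal[symmetric] integral_nonneg_AE) simp
  also have "\<dots> = (\<Sum>i\<in>K. \<integral>\<^sup>+\<omega>. ennreal ((S i \<omega>)\<^sup>2) \<partial>Q)"
    using sq by (intro sum.cong refl nn_integral_eq_integral[symmetric]) auto
  finally show ?thesis .
qed

lemma ennreal_le_if_le_scaled:
  fixes x :: ennreal and c :: real
  assumes "\<And>\<epsilon>. \<epsilon> > 0 \<Longrightarrow> x \<le> ennreal ((1 + \<epsilon>)\<^sup>2 * c)"
  shows "x \<le> ennreal c"
proof (rule tendsto_lowerbound)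
  have "((\<lambda>\<epsilon>. (1 + \<epsilon>)\<^sup>2 * c) \<longlongrightarrow> (1 + 0)\<^sup>2 * c) (at_right 0)"
    by (intro tendsto_intros)
  then show "((\<lambda>\<epsilon>. ennreal ((1 + \<epsilon>)\<^sup>2 * c)) \<longlongrightarrow> ennreal c) (at_right 0)"
    by (intro tendsto_ennrealI) simp
  show "\<forall>\<^sub>F \<epsilon> in at_right 0. x \<le> ennreal ((1 + \<epsilon>)\<^sup>2 * c)"
    using assms by (auto simp: eventually_at_right_field intro: exI[of _ 1])
qed simp

text \<open>The second moment of a sum of \<open>N\<close> independent noise terms grows like \<open>N\<close> and not like \<open>N\<^sup>2\<close>.
  Independence and centring enter through the simple integrals, which are functions of the paths;
  their sum converges in \<open>L\<^sup>2\<close> to the sum of the Ito integrals and takes the bound to the limit.\<close>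

lemma sum_ito_integrals_second_moment:
  assumes Q: "prob_space Q" and T: "0 < T"
    and mono: "mono_on {0..T} q" and cont: "continuous_on {0..T} q" and h: "in_L2 T q h"
    and ind: "prob_space.indep_vars Q (\<lambda>_. path_space T) (\<lambda>i. path T (Ms i)) {1..N}"
    and M: "\<And>i. i \<in> {1..N} \<Longrightarrow>
      has_deterministic_bracket Q (natural_filtration Q (Ms i)) T (Ms i) q"
    and A: "\<And>i. i \<in> {1..N} \<Longrightarrow> AE \<omega> in Q. \<forall>t\<in>{0..T}. A i t \<omega> = q t"
    and X: "\<And>i. i \<in> {1..N} \<Longrightarrow>
      has_ito_integral Q (natural_filtration Q (Ms i)) T (Ms i) (A i) (\<lambda>s _. h s) (X i)"
  shows "(\<integral>\<^sup>+\<omega>. ennreal ((\<Sum>i=1..N. X i \<omega>)\<^sup>2) \<partial>Q) \<le> ennreal (real N * sqnorm T q h)"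
proof -
  interpret prob_space Q by (rule Q)
  let ?F = "\<lambda>i. natural_filtration Q (Ms i)"
  have "\<forall>i\<in>{1..N}. \<exists>S \<delta>. (\<forall>l. S l \<in> borel_measurable (?F i T)) \<and>
    (\<forall>l. integrable Q (\<lambda>\<omega>. (S l \<omega>)\<^sup>2)) \<and> (\<forall>l. (\<integral>\<omega>. S l \<omega> \<partial>Q) = 0) \<and>
    (\<lambda>l. \<integral>\<^sup>+\<omega>. ennreal ((S l \<omega> - X i \<omega>)\<^sup>2) \<partial>Q) \<longlonglongrightarrow> 0 \<and> (\<delta> :: nat \<Rightarrow> ennreal) \<longlonglongrightarrow> 0 \<and>
    (\<forall>\<epsilon>>0. \<forall>l. (\<integral>\<^sup>+\<omega>. ennreal ((S l \<omega>)\<^sup>2) \<partial>Q)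
        \<le> ennreal (1 + \<epsilon>) * ennreal (sqnorm T q h) + ennreal (1 + 1 / \<epsilon>) * \<delta> l)"
    (is "\<forall>i\<in>{1..N}. ?approx i")
  proof
    fix i assume i: "i \<in> {1..N}"
    show "?approx i"
      by (rule ito_integral_approximation[OF Q M[OF i] T mono cont A[OF i] h X[OF i]]) blast
  qed
  from bchoice[OF this] obtain S where "\<forall>i\<in>{1..N}. \<exists>\<delta>. (\<forall>l. S i l \<in> borel_measurable (?F i T)) \<and>
    (\<forall>l. integrable Q (\<lambda>\<omega>. (S i l \<omega>)\<^sup>2)) \<and> (\<forall>l. (\<integral>\<omega>. S i l \<omega> \<partial>Q) = 0) \<and>
    (\<lambda>l. \<integral>\<^sup>+\<omega>. ennreal ((S i l \<omega> - X i \<omega>)\<^sup>2) \<partial>Q) \<longlonglongrightarrow> 0 \<and> (\<delta> :: nat \<Rightarrow> ennreal) \<longlonglongrightarrow> 0 \<and>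
    (\<forall>\<epsilon>>0. \<forall>l. (\<integral>\<^sup>+\<omega>. ennreal ((S i l \<omega>)\<^sup>2) \<partial>Q)
        \<le> ennreal (1 + \<epsilon>) * ennreal (sqnorm T q h) + ennreal (1 + 1 / \<epsilon>) * \<delta> l)" ..
  from bchoice[OF this] obtain \<delta> :: "nat \<Rightarrow> nat \<Rightarrow> ennreal" where
    S_all: "\<forall>i\<in>{1..N}. (\<forall>l. S i l \<in> borel_measurable (?F i T)) \<and>
    (\<forall>l. integrable Q (\<lambda>\<omega>. (S i l \<omega>)\<^sup>2)) \<and> (\<forall>l. (\<integral>\<omega>. S i l \<omega> \<partial>Q) = 0) \<and>
    (\<lambda>l. \<integral>\<^sup>+\<omega>. ennreal ((S i l \<omega> - X i \<omega>)\<^sup>2) \<partial>Q) \<longlonglongrightarrow> 0 \<and> \<delta> i \<longlonglongrightarrow> 0 \<and>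
    (\<forall>\<epsilon>>0. \<forall>l. (\<integral>\<^sup>+\<omega>. ennreal ((S i l \<omega>)\<^sup>2) \<partial>Q)
        \<le> ennreal (1 + \<epsilon>) * ennreal (sqnorm T q h) + ennreal (1 + 1 / \<epsilon>) * \<delta> i l)" ..
  have S_meas: "S i l \<in> borel_measurable (?F i T)" and S_sq: "integrable Q (\<lambda>\<omega>. (S i l \<omega>)\<^sup>2)"
    and S_mean: "(\<integral>\<omega>. S i l \<omega> \<partial>Q) = 0"
    and S_lim: "(\<lambda>l. \<integral>\<^sup>+\<omega>. ennreal ((S i l \<omega> - X i \<omega>)\<^sup>2) \<partial>Q) \<longlonglongrightarrow> 0" and \<delta>_lim: "\<delta> i \<longlonglongrightarrow> 0"
    and S_bound: "\<epsilon> > 0 \<Longrightarrow> (\<integral>\<^sup>+\<omega>. ennreal ((S i l \<omega>)\<^sup>2) \<partial>Q)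
        \<le> ennreal (1 + \<epsilon>) * ennreal (sqnorm T q h) + ennreal (1 + 1 / \<epsilon>) * \<delta> i l"
    if "i \<in> {1..N}" for i l \<epsilon>
    using S_all that by blast+
  have S_Q: "S i l \<in> borel_measurable Q" if "i \<in> {1..N}" for i l
  proof -
    have "is_filtration Q T (?F i)"
      using M[OF that] by (auto simp: has_deterministic_bracket_def is_martingale_def)
    moreover have "T \<in> {0..T}" using T by simp
    ultimately show ?thesis
      using S_meas[OF that, of l] by (rule filtration_measurable[where F = "?F i" and t = T])
  qed
  have X_Q: "X i \<in> borel_measurable Q" if "i \<in> {1..N}" for i
    using X[OF that] by (simp add: has_ito_integral_def)
  have pos: "0 \<le> sqnorm T q h" by (simp add: sqnorm_eq_inner_L2 inner_L2_nonneg)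
  define \<eta> where "\<eta> l = (\<Sum>i=1..N. \<integral>\<^sup>+\<omega>. ennreal ((S i l \<omega> - X i \<omega>)\<^sup>2) \<partial>Q)" for l
  \<comment> \<open>The Cauchy-Schwarz inequality for sums of \<open>N\<close> terms gives the factor \<open>N\<close>.\<close>
  have error: "(\<integral>\<^sup>+\<omega>. ennreal (((\<Sum>i=1..N. S i l \<omega>) - (\<Sum>i=1..N. X i \<omega>))\<^sup>2) \<partial>Q) \<le> ennreal (real N) * \<eta> l" for l
  proof -
    have "(\<integral>\<^sup>+\<omega>. ennreal (((\<Sum>i=1..N. S i l \<omega>) - (\<Sum>i=1..N. X i \<omega>))\<^sup>2) \<partial>Q)
      \<le> (\<integral>\<^sup>+\<omega>. ennreal (real N) * (\<Sum>i=1..N. ennreal ((S i l \<omega> - X i \<omega>)\<^sup>2)) \<partial>Q)"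
    proof (rule nn_integral_mono)
      fix \<omega>
      have "((\<Sum>i=1..N. S i l \<omega>) - (\<Sum>i=1..N. X i \<omega>))\<^sup>2 \<le> (\<Sum>i=1..N. (S i l \<omega> - X i \<omega>)\<^sup>2) * real N"
        using sum_squared_le_sum_of_squares[of "\<lambda>i. S i l \<omega> - X i \<omega>" "{1..N}"]
        by (simp add: sum_subtractf)
      then show "ennreal (((\<Sum>i=1..N. S i l \<omega>) - (\<Sum>i=1..N. X i \<omega>))\<^sup>2)
          \<le> ennreal (real N) * (\<Sum>i=1..N. ennreal ((S i l \<omega> - X i \<omega>)\<^sup>2))"
        by (subst sum_ennreal) (auto simp: ennreal_mult[symmetric] sum_nonneg mult.commute intro!: ennreal_leI)
    qed
    also have "\<dots> = ennreal (real N) * \<eta> l"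
    proof -
      have meas: "(\<lambda>\<omega>. ennreal ((S i l \<omega> - X i \<omega>)\<^sup>2)) \<in> borel_measurable Q" if "i \<in> {1..N}" for i
        using S_Q[OF that, of l] X_Q[OF that] by measurable
      have "\<eta> l = (\<integral>\<^sup>+\<omega>. (\<Sum>i=1..N. ennreal ((S i l \<omega> - X i \<omega>)\<^sup>2)) \<partial>Q)"
        unfolding \<eta>_def by (rule nn_integral_sum[symmetric]) (rule meas)
      moreover have "(\<lambda>\<omega>. \<Sum>i=1..N. ennreal ((S i l \<omega> - X i \<omega>)\<^sup>2)) \<in> borel_measurable Q"
        by (rule borel_measurable_sum) (rule meas)
      ultimately show ?thesis by (simp only: nn_integral_cmult)
    qed
    finally show ?thesis .
  qed
  show ?thesis
  proof (rule ennreal_le_if_le_scaled)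
    fix \<epsilon> :: real assume \<epsilon>: "\<epsilon> > 0"
    let ?c = "ennreal (1 + \<epsilon>)" and ?d = "ennreal (1 + 1 / \<epsilon>)"
    have "(\<integral>\<^sup>+\<omega>. ennreal ((\<Sum>i=1..N. X i \<omega>)\<^sup>2) \<partial>Q)
        \<le> ?c * (\<Sum>i=1..N. ?c * ennreal (sqnorm T q h) + ?d * \<delta> i l) + ?d * (ennreal (real N) * \<eta> l)" for l
    proof -
      have "(\<integral>\<^sup>+\<omega>. ennreal ((\<Sum>i=1..N. X i \<omega>)\<^sup>2) \<partial>Q)
        \<le> ?c * (\<integral>\<^sup>+\<omega>. ennreal ((\<Sum>i=1..N. S i l \<omega>)\<^sup>2) \<partial>Q)
          + ?d * (\<integral>\<^sup>+\<omega>. ennreal (((\<Sum>i=1..N. S i l \<omega>) - (\<Sum>i=1..N. X i \<omega>))\<^sup>2) \<partial>Q)"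
        by (rule nn_integral_square_split[OF _ _ \<epsilon>]) (auto intro!: borel_measurable_sum X_Q S_Q)
      also have "(\<integral>\<^sup>+\<omega>. ennreal ((\<Sum>i=1..N. S i l \<omega>)\<^sup>2) \<partial>Q)
          = (\<Sum>i=1..N. \<integral>\<^sup>+\<omega>. ennreal ((S i l \<omega>)\<^sup>2) \<partial>Q)"
        by (rule centered_independent_sum_square[OF Q ind]) (auto intro: S_meas S_Q S_sq S_mean)
      also have "?c * (\<Sum>i=1..N. \<integral>\<^sup>+\<omega>. ennreal ((S i l \<omega>)\<^sup>2) \<partial>Q)
          + ?d * (\<integral>\<^sup>+\<omega>. ennreal (((\<Sum>i=1..N. S i l \<omega>) - (\<Sum>i=1..N. X i \<omega>))\<^sup>2) \<partial>Q)
        \<le> ?c * (\<Sum>i=1..N. ?c * ennreal (sqnorm T q h) + ?d * \<delta> i l) + ?d * (ennreal (real N) * \<eta> l)"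
        by (intro add_mono mult_left_mono sum_mono S_bound \<epsilon> error) auto
      finally show ?thesis .
    qed
    moreover have "(\<lambda>l. ?c * (\<Sum>i=1..N. ?c * ennreal (sqnorm T q h) + ?d * \<delta> i l) + ?d * (ennreal (real N) * \<eta> l))
      \<longlonglongrightarrow> ?c * (\<Sum>i=1..N. ?c * ennreal (sqnorm T q h) + ?d * 0) + ?d * (ennreal (real N) * (\<Sum>i=1..N. 0))"
      unfolding \<eta>_def
      by (intro tendsto_add ennreal_tendsto_cmult tendsto_sum tendsto_const \<delta>_lim S_lim) auto
    ultimately have "(\<integral>\<^sup>+\<omega>. ennreal ((\<Sum>i=1..N. X i \<omega>)\<^sup>2) \<partial>Q)
      \<le> ?c * (\<Sum>i=1..N. ?c * ennreal (sqnorm T q h) + ?d * 0) + ?d * (ennreal (real N) * (\<Sum>i=1..N. 0))"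
      by (intro LIMSEQ_le_const) auto
    also have "\<dots> = ennreal ((1 + \<epsilon>)\<^sup>2 * (real N * sqnorm T q h))"
    proof -
      have "ennreal ((1 + \<epsilon>)\<^sup>2 * (real N * sqnorm T q h)) = ?c * (?c * (ennreal (real N) * ennreal (sqnorm T q h)))"
        using \<epsilon> pos by (simp add: ennreal_mult power2_eq_square mult.assoc del: ennreal_plus)
      then show ?thesis by (simp add: ennreal_of_nat_eq_real_of_nat ac_simps del: ennreal_plus)
    qed
    finally show "(\<integral>\<^sup>+\<omega>. ennreal ((\<Sum>i=1..N. X i \<omega>)\<^sup>2) \<partial>Q)
      \<le> ennreal ((1 + \<epsilon>)\<^sup>2 * (real N * sqnorm T q h))" .
  qed
qed

section \<open>The least squares estimator\<close>

lemma inner_L2_expand: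
  assumes f: "in_L2 T q f" and g: "in_L2 T q g"
  shows "inner_L2 T q (\<lambda>s. a * f s + b * g s) (\<lambda>s. a * f s + b * g s)
    = a\<^sup>2 * inner_L2 T q f f + 2 * a * b * inner_L2 T q f g + b\<^sup>2 * inner_L2 T q g g"
proof -
  have h: "in_L2 T q (\<lambda>s. a * f s + b * g s)" by (rule in_L2_lincomb[OF f g])
  have "inner_L2 T q (\<lambda>s. a * f s + b * g s) (\<lambda>s. a * f s + b * g s)
    = a * inner_L2 T q (\<lambda>s. a * f s + b * g s) f + b * inner_L2 T q (\<lambda>s. a * f s + b * g s) g"
    unfolding inner_L2_lincomb[OF f g h] inner_L2_commute[of T q f] inner_L2_commute[of T q g] ..
  also have "\<dots> = a * (a * inner_L2 T q f f + b * inner_L2 T q g f)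
      + b * (a * inner_L2 T q f g + b * inner_L2 T q g g)"
    unfolding inner_L2_lincomb[OF f g f] inner_L2_lincomb[OF f g g] ..
  also have "inner_L2 T q g f = inner_L2 T q f g" by (rule inner_L2_commute)
  finally show ?thesis by (simp add: power2_eq_square algebra_simps)
qed

text \<open>Pythagoras: the first two terms on the right are the squared distance of \<open>J\<^sub>0\<close> to the
  span of \<open>E\<close>, the last one is the squared distance of \<open>J\<close> to the projection of \<open>J\<^sub>0\<close>, expressed
  in coordinates. The two assumptions are the Parseval identities that
  \<open>semidefinite_orthonormal_family\<close> supplies.\<close>

lemma sqnorm_diff_coordinates:
  assumes J: "in_L2 T q J" and J0: "in_L2 T q J\<^sub>0"
    and JJ: "inner_L2 T q J J = (\<Sum>e\<in>E. inner_L2 T q J e * inner_L2 T q e J)"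
    and JJ0: "inner_L2 T q J J\<^sub>0 = (\<Sum>e\<in>E. inner_L2 T q J e * inner_L2 T q e J\<^sub>0)"
  shows "sqnorm T q (\<lambda>s. J s - J\<^sub>0 s)
    = sqnorm T q J\<^sub>0 - (\<Sum>e\<in>E. (inner_L2 T q e J\<^sub>0)\<^sup>2)
      + (\<Sum>e\<in>E. (inner_L2 T q J e - inner_L2 T q e J\<^sub>0)\<^sup>2)"
proof -
  have "sqnorm T q (\<lambda>s. J s - J\<^sub>0 s)
      = inner_L2 T q J J - 2 * inner_L2 T q J J\<^sub>0 + inner_L2 T q J\<^sub>0 J\<^sub>0"
    using inner_L2_expand[OF J J0, of 1 "-1"] by (simp add: sqnorm_eq_inner_L2)
  also have "inner_L2 T q J J = (\<Sum>e\<in>E. (inner_L2 T q J e)\<^sup>2)"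
    unfolding JJ by (intro sum.cong refl) (simp add: power2_eq_square inner_L2_commute[of T q J])
  finally show ?thesis
    unfolding JJ0 sqnorm_eq_inner_L2
    by (simp add: power2_diff sum.distrib sum_subtractf sum_distrib_left algebra_simps)
qed

text \<open>The normal equations. Up to a constant, the contrast is
  \<open>\<parallel>J - J\<^sub>0\<parallel>\<^sup>2 - 2 W J\<close> with the noise \<open>W\<close> as a linear functional; in the direction of a unit vector
  \<open>e\<close> it is the quadratic \<open>x\<^sup>2 + 2 b x\<close>, where \<open>b\<close> is the defect of the equation to be shown, and
  moving by \<open>x = -b\<close> would decrease it by \<open>b\<^sup>2\<close>.\<close>

lemma contrast_minimiser_coordinate:
  assumes lin: "\<And>a b f g. f \<in> S \<Longrightarrow> g \<in> S \<Longrightarrow> (\<lambda>s. a * f s + b * g s) \<in> S"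
    and S: "\<And>f. f \<in> S \<Longrightarrow> in_L2 T q f" and J0: "in_L2 T q J\<^sub>0"
    and W: "linear_on_funs S W"
    and J: "J \<in> S"
    and min: "\<And>K. K \<in> S \<Longrightarrow> inner_L2 T q J J - 2 * inner_L2 T q J J\<^sub>0 - 2 * W J
        \<le> inner_L2 T q K K - 2 * inner_L2 T q K J\<^sub>0 - 2 * W K"
    and e: "e \<in> S" "inner_L2 T q e e = 1"
  shows "inner_L2 T q J e - inner_L2 T q e J\<^sub>0 = W e"
proof -
  define b where "b = inner_L2 T q J e - inner_L2 T q e J\<^sub>0 - W e"
  define K where "K = (\<lambda>s. 1 * J s + (- b) * e s)"
  have "inner_L2 T q K K = inner_L2 T q J J - 2 * b * inner_L2 T q J e + b\<^sup>2"
    unfolding K_def inner_L2_expand[OF S[OF J] S[OF e(1)]] using e(2) by simp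
  moreover have "inner_L2 T q K J\<^sub>0 = inner_L2 T q J J\<^sub>0 - b * inner_L2 T q e J\<^sub>0"
    unfolding K_def inner_L2_lincomb[OF S[OF J] S[OF e(1)] J0] by simp
  moreover have "W K = 1 * W J + (- b) * W e"
    using W J e(1) unfolding linear_on_funs_def K_def by blast
  moreover have "K \<in> S" unfolding K_def by (intro lin J e)
  ultimately have "0 \<le> b\<^sup>2 - 2 * b * b"
    using min[of K] by (simp add: b_def algebra_simps)
  then have "b\<^sup>2 \<le> 0" by (simp add: power2_eq_square)
  then have "b = 0" by simp
  then show ?thesis by (simp add: b_def)
qed

theorem proposition1:
  fixes T :: real
    and P :: "'a measure" and F :: "real \<Rightarrow> 'a measure" and M :: "real \<Rightarrow> 'a \<Rightarrow> real"
    and q J\<^sub>0 :: "real \<Rightarrow> real"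
    and N m :: nat and \<phi> :: "nat \<Rightarrow> real \<Rightarrow> real"
    and Q :: "'b measure" and Ms A :: "nat \<Rightarrow> real \<Rightarrow> 'b \<Rightarrow> real"
    and I :: "nat \<Rightarrow> (real \<Rightarrow> real) \<Rightarrow> 'b \<Rightarrow> real" and Jhat :: "'b \<Rightarrow> real \<Rightarrow> real"
  assumes T: "T > 0"
    and P: "prob_space P"
    and M: "is_continuous_L2_martingale P F T M"
    and M_0: "AE \<omega> in P. M 0 \<omega> = 0"
    and M_nonzero: "\<not> (AE \<omega> in P. \<forall>t\<in>{0..T}. M t \<omega> = 0)"
    and M_qv: "is_quadratic_variation P F T M (\<lambda>t _. q t)"
    and J0: "in_L2 T q J\<^sub>0"
    and N: "N \<ge> 1"
    and m: "m \<in> {1..N}"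
    and \<phi>_cont: "\<And>j. j \<in> {1..N} \<Longrightarrow> continuous_on {0..T} (\<phi> j)"
    and \<phi>_orth: "orthonormal_family T N \<phi>"
    and Q: "prob_space Q"
    and copies: "independent_copies Q P T N Ms M"
    and copies_qv: "\<And>i. i \<in> {1..N} \<Longrightarrow>
          is_quadratic_variation Q (natural_filtration Q (Ms i)) T (Ms i) (A i)"
    and integrals: "is_integral_family Q T q J\<^sub>0 N Ms A (fun_span m \<phi>) I"
    and estimator: "is_ls_estimator Q T N A I (fun_span m \<phi>) Jhat"
  shows "(\<integral>\<^sup>+\<omega>. ennreal (sqnorm T q (\<lambda>s. Jhat \<omega> s - J\<^sub>0 s)) \<partial>Q)
           \<le> ennreal ((INF J\<in>fun_span m \<phi>. sqnorm T q (\<lambda>s. J s - J\<^sub>0 s)) + 2 * real m / real N)"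
proof -
  interpret P: prob_space P by (rule P)
  interpret Q: prob_space Q by (rule Q)
  have q: "q 0 = 0" "mono_on {0..T} q" "continuous_on {0..T} q"
    using M_qv by (auto simp: is_quadratic_variation_def)
  have mart: "is_martingale P F T M" "is_martingale P F T (\<lambda>t \<omega>. (M t \<omega>)\<^sup>2 - q t)"
    using M M_qv by (auto simp: is_continuous_L2_martingale_def is_quadratic_variation_def)
  have filt: "is_filtration P T F" using mart(1) by (simp add: is_martingale_def)
  have adapted: "M t \<in> borel_measurable (F t)" if "t \<in> {0..T}" for t
    using martingale_measurable(1)[OF mart(1) that] .
  have ind: "Q.indep_vars (\<lambda>_. path_space T) (\<lambda>i. path T (Ms i)) {1..N}"
    and law: "\<And>i. i \<in> {1..N} \<Longrightarrow>
      distr Q (path_space T) (path T (Ms i)) = distr P (path_space T) (path T M)"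
    using copies by (auto simp: independent_copies_def)
  have path: "path T (Ms i) \<in> measurable Q (path_space T)" if "i \<in> {1..N}" for i
    using ind that by (simp add: Q.indep_vars_def)
  have bracket: "has_deterministic_bracket Q (natural_filtration Q (Ms i)) T (Ms i) q"
    if i: "i \<in> {1..N}" for i
    unfolding has_deterministic_bracket_def
    using martingale_same_law[OF P Q filt adapted, where g = "\<lambda>_ x. x", OF _ mart(1) _ path[OF i] law[OF i]]
      martingale_same_law[OF P Q filt adapted, where g = "\<lambda>t x. x\<^sup>2 - q t", OF _ mart(2) _ path[OF i] law[OF i]]
    by simp
  have A_eq: "AE \<omega> in Q. \<forall>t\<in>{0..T}. A i t \<omega> = q t" if i: "i \<in> {1..N}" for i
    by (rule deterministic_bracket_unique_path[OF Q T bracket[OF i] q copies_qv[OF i]])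

  let ?S = "fun_span m \<phi>" and ?B = "inner_L2 T q"
  have \<phi>_L2: "in_L2 T q (\<phi> j)" if "j \<in> {1..m}" for j
    using m that by (intro continuous_in_L2[OF T q(2,3)] \<phi>_cont) auto
  have zero_L2: "in_L2 T q (\<lambda>_. 0)" by (intro continuous_in_L2[OF T q(2,3)]) auto
  have "\<exists>E. finite E \<and> card E \<le> m \<and> E \<subseteq> ?S \<inter> Collect (in_L2 T q) \<and>
    (\<forall>e\<in>E. \<forall>e'\<in>E. ?B e e' = (if e = e' then 1 else 0)) \<and>
    (\<forall>J\<in>?S. J \<in> Collect (in_L2 T q) \<and> (\<forall>h\<in>Collect (in_L2 T q). ?B J h = (\<Sum>e\<in>E. ?B J e * ?B e h)))"
    by (rule semidefinite_orthonormal_family)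
      (use in_L2_lincomb inner_L2_lincomb inner_L2_nonneg \<phi>_L2 zero_L2 in \<open>auto intro: inner_L2_commute\<close>)
  then obtain E where E: "finite E" "card E \<le> m" "E \<subseteq> ?S"
    and on: "\<And>e. e \<in> E \<Longrightarrow> ?B e e = 1"
    and S_L2: "\<And>J. J \<in> ?S \<Longrightarrow> in_L2 T q J"
    and parseval: "\<And>J h. J \<in> ?S \<Longrightarrow> in_L2 T q h \<Longrightarrow> ?B J h = (\<Sum>e\<in>E. ?B J e * ?B e h)"
    by auto
  \<comment> \<open>\<open>\<rho>\<close> is the squared distance of \<open>J\<^sub>0\<close> to the span, and \<open>W \<omega> J\<close> below is the
    empirical mean of the noise \<open>\<integral>J dM\<^sup>i\<close>.\<close>
  define \<rho> where "\<rho> = sqnorm T q J\<^sub>0 - (\<Sum>e\<in>E. (?B e J\<^sub>0)\<^sup>2)"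
  have dist: "sqnorm T q (\<lambda>s. J s - J\<^sub>0 s) = \<rho> + (\<Sum>e\<in>E. (?B J e - ?B e J\<^sub>0)\<^sup>2)" if J: "J \<in> ?S" for J
    unfolding \<rho>_def by (rule sqnorm_diff_coordinates[OF S_L2[OF J] J0]) (intro parseval J J0 S_L2[OF J])+

  define X where "X i J \<omega> = I i J \<omega> - ?B J J\<^sub>0" for i J \<omega>
  define W where "W \<omega> J = 1 / real N * (\<Sum>i=1..N. X i J \<omega>)" for \<omega> J
  have X_ito: "has_ito_integral Q (natural_filtration Q (Ms i)) T (Ms i) (A i) (\<lambda>s _. J s) (X i J)"
    if "i \<in> {1..N}" "J \<in> ?S" for i J
  proof -
    have "has_Z_integral Q (natural_filtration Q (Ms i)) T q J\<^sub>0 (Zproc T q J\<^sub>0 (Ms i)) (A i) J (I i J)"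
      using integrals that by (simp add: is_integral_family_def)
    then show ?thesis
      by (simp add: has_Z_integral_def Zproc_def X_def[abs_def] inner_L2_def)
  qed
  have W_linear: "linear_on_funs ?S (W \<omega>)" if "\<omega> \<in> space Q" for \<omega>
    unfolding linear_on_funs_def
  proof (intro ballI allI)
    fix f g a b assume fg: "f \<in> ?S" "g \<in> ?S"
    have "X i (\<lambda>s. a * f s + b * g s) \<omega> = a * X i f \<omega> + b * X i g \<omega>" if i: "i \<in> {1..N}" for i
    proof -
      have "linear_on_funs ?S (\<lambda>J. I i J \<omega>)"
        using integrals i \<open>\<omega> \<in> space Q\<close> by (simp add: is_integral_family_def)
      then have "I i (\<lambda>s. a * f s + b * g s) \<omega> = a * I i f \<omega> + b * I i g \<omega>"
        using fg unfolding linear_on_funs_def by blast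
      then show ?thesis
        using inner_L2_lincomb[OF S_L2[OF fg(1)] S_L2[OF fg(2)] J0, of a b]
        by (simp add: X_def algebra_simps)
    qed
    then have "(\<Sum>i=1..N. X i (\<lambda>s. a * f s + b * g s) \<omega>)
        = a * (\<Sum>i=1..N. X i f \<omega>) + b * (\<Sum>i=1..N. X i g \<omega>)"
      by (simp add: sum.distrib sum_distrib_left)
    then show "W \<omega> (\<lambda>s. a * f s + b * g s) = a * W \<omega> f + b * W \<omega> g"
      by (simp add: W_def algebra_simps)
  qed
  have contrast_eq: "contrast T N A I \<omega> J = ?B J J - 2 * ?B J J\<^sub>0 - 2 * W \<omega> J"
    if "\<forall>i\<in>{1..N}. \<forall>t\<in>{0..T}. A i t \<omega> = q t" for \<omega> J
  proof -
    have "(\<Sum>i=1..N. (LINT s:{0..T}|stieltjes T (\<lambda>t. A i t \<omega>). (J s)\<^sup>2) - 2 * I i J \<omega>)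
        = (\<Sum>i=1..N. (?B J J - 2 * ?B J J\<^sub>0) - 2 * X i J \<omega>)"
    proof (rule sum.cong[OF refl])
      fix i assume "i \<in> {1..N}"
      then have "stieltjes T (\<lambda>t. A i t \<omega>) = stieltjes T q"
        using that by (intro stieltjes_cong[OF T]) auto
      then show "(LINT s:{0..T}|stieltjes T (\<lambda>t. A i t \<omega>). (J s)\<^sup>2) - 2 * I i J \<omega>
          = (?B J J - 2 * ?B J J\<^sub>0) - 2 * X i J \<omega>"
        by (simp add: X_def inner_L2_def power2_eq_square)
    qed
    also have "\<dots> = real N * (?B J J - 2 * ?B J J\<^sub>0) - 2 * (\<Sum>i=1..N. X i J \<omega>)"
      by (simp add: sum_subtractf sum_distrib_left)
    finally show ?thesis
      using N by (simp add: contrast_def W_def field_simps)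
  qed

  \<comment> \<open>The estimator misses the projection of \<open>J\<^sub>0\<close> by exactly the noise in each coordinate.\<close>
  have loss: "AE \<omega> in Q. sqnorm T q (\<lambda>s. Jhat \<omega> s - J\<^sub>0 s) = \<rho> + (\<Sum>e\<in>E. (W \<omega> e)\<^sup>2)"
  proof -
    have "AE \<omega> in Q. \<forall>i\<in>{1..N}. \<forall>t\<in>{0..T}. A i t \<omega> = q t"
      by (intro AE_finite_allI A_eq) auto
    moreover have "AE \<omega> in Q. is_arg_min (contrast T N A I \<omega>) (\<lambda>J. J \<in> ?S) (Jhat \<omega>)"
      using estimator by (simp add: is_ls_estimator_def)
    ultimately show ?thesis using AE_space
    proof eventually_elim
      case (elim \<omega>)
      have J: "Jhat \<omega> \<in> ?S" using elim(2) by (simp add: is_arg_min_def)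
      have min: "?B (Jhat \<omega>) (Jhat \<omega>) - 2 * ?B (Jhat \<omega>) J\<^sub>0 - 2 * W \<omega> (Jhat \<omega>)
          \<le> ?B K K - 2 * ?B K J\<^sub>0 - 2 * W \<omega> K" if "K \<in> ?S" for K
        using elim(2) that unfolding is_arg_min_def contrast_eq[OF elim(1)] by (meson not_less)
      have "?B (Jhat \<omega>) e - ?B e J\<^sub>0 = W \<omega> e" if "e \<in> E" for e
        using that E(3) on[OF that]
        by (intro contrast_minimiser_coordinate[OF fun_span_lincomb S_L2 J0 W_linear[OF elim(3)] J min]) auto
      then show ?case unfolding dist[OF J] by simp
    qed
  qed

  have W_meas: "(\<lambda>\<omega>. W \<omega> e) \<in> borel_measurable Q" if "e \<in> E" for e
  proof -
    have "X i e \<in> borel_measurable Q" if "i \<in> {1..N}" for i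
      using X_ito[OF that, of e] \<open>e \<in> E\<close> E(3) by (auto simp: has_ito_integral_def)
    then show ?thesis unfolding W_def by (intro borel_measurable_times borel_measurable_sum) auto
  qed
  have noise: "(\<integral>\<^sup>+\<omega>. ennreal ((W \<omega> e)\<^sup>2) \<partial>Q) \<le> ennreal (1 / real N)" if e: "e \<in> E" for e
  proof -
    have eS: "e \<in> ?S" using e E(3) by auto
    have meas: "(\<lambda>\<omega>. \<Sum>i=1..N. X i e \<omega>) \<in> borel_measurable Q"
      using X_ito[OF _ eS] by (intro borel_measurable_sum) (auto simp: has_ito_integral_def)
    have "(\<integral>\<^sup>+\<omega>. ennreal ((W \<omega> e)\<^sup>2) \<partial>Q)
        = ennreal ((1 / real N)\<^sup>2) * (\<integral>\<^sup>+\<omega>. ennreal ((\<Sum>i=1..N. X i e \<omega>)\<^sup>2) \<partial>Q)"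
      using meas by (subst nn_integral_cmult[symmetric])
        (auto simp: W_def power_mult_distrib power_divide ennreal_mult[symmetric] intro!: nn_integral_cong)
    also have "\<dots> \<le> ennreal ((1 / real N)\<^sup>2) * ennreal (real N * sqnorm T q e)"
      by (intro mult_left_mono
          sum_ito_integrals_second_moment[OF Q T q(2,3) S_L2[OF eS] ind bracket A_eq X_ito[OF _ eS]]) auto
    also have "\<dots> = ennreal (1 / real N)"
      using N on[OF e] by (simp add: sqnorm_eq_inner_L2 ennreal_mult[symmetric] power2_eq_square)
    finally show ?thesis .
  qed

  let ?inf = "INF J\<in>?S. sqnorm T q (\<lambda>s. J s - J\<^sub>0 s)"
  have S_ne: "?S \<noteq> {}" using zero_in_fun_span by blast
  have "\<rho> \<le> ?inf"
    by (rule cINF_greatest[OF S_ne]) (simp add: dist sum_nonneg)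
  moreover have "0 \<le> ?inf"
    by (rule cINF_greatest[OF S_ne]) (simp add: sqnorm_eq_inner_L2 inner_L2_nonneg)
  ultimately have inf: "\<rho> \<le> ?inf" "0 \<le> ?inf" .
  have "(\<integral>\<^sup>+\<omega>. ennreal (sqnorm T q (\<lambda>s. Jhat \<omega> s - J\<^sub>0 s)) \<partial>Q)
      = (\<integral>\<^sup>+\<omega>. ennreal (\<rho> + (\<Sum>e\<in>E. (W \<omega> e)\<^sup>2)) \<partial>Q)"
    using loss by (intro nn_integral_cong_AE) auto
  also have "\<dots> \<le> (\<integral>\<^sup>+\<omega>. ennreal ?inf + (\<Sum>e\<in>E. ennreal ((W \<omega> e)\<^sup>2)) \<partial>Q)"
  proof (rule nn_integral_mono)
    fix \<omega>
    have "ennreal (\<rho> + (\<Sum>e\<in>E. (W \<omega> e)\<^sup>2)) \<le> ennreal (?inf + (\<Sum>e\<in>E. (W \<omega> e)\<^sup>2))"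
      using inf(1) by (intro ennreal_leI) simp
    also have "\<dots> = ennreal ?inf + (\<Sum>e\<in>E. ennreal ((W \<omega> e)\<^sup>2))"
      using inf(2) by (simp add: sum_nonneg ennreal_plus)
    finally show "ennreal (\<rho> + (\<Sum>e\<in>E. (W \<omega> e)\<^sup>2)) \<le> ennreal ?inf + (\<Sum>e\<in>E. ennreal ((W \<omega> e)\<^sup>2))" .
  qed
  also have "\<dots> = ennreal ?inf + (\<Sum>e\<in>E. \<integral>\<^sup>+\<omega>. ennreal ((W \<omega> e)\<^sup>2) \<partial>Q)"
    using W_meas
    by (subst nn_integral_add) (auto simp: nn_integral_sum Q.emeasure_space_1 simp del: sum_ennreal intro!: borel_measurable_sum)
  also have "\<dots> \<le> ennreal ?inf + (\<Sum>e\<in>E. ennreal (1 / real N))"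
    by (intro add_left_mono sum_mono noise)
  also have "(\<Sum>e\<in>E. ennreal (1 / real N)) = ennreal (real (card E) / real N)"
    by (subst sum_ennreal) auto
  also have "ennreal ?inf + \<dots> = ennreal (?inf + real (card E) / real N)"
    using inf(2) by (simp add: ennreal_plus)
  also have "\<dots> \<le> ennreal (?inf + 2 * real m / real N)"
    using E(2) by (intro ennreal_leI add_left_mono divide_right_mono) auto
  finally show ?thesis .
qed

end
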